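(* Let $W$ be a function on $\overline{\mathbb{C}_+}$ of the form $$W(z)= e^{Az+C+\frac{A_0}{z}}\, z^{B}\,\frac{\prod_{\nu>0} \left(1+\frac{z}{a_\nu}\right)^{\kappa_\nu}}{\prod_{\mu>0} \left(1-\frac{z}{b_\mu}\right)^{\lambda_\mu}}\cdot\frac{\prod_{\nu>0} \left(1+\frac{1}{zc_\nu}\right)^{\widetilde\kappa_\nu}}{\prod_{\mu>0} \left(1-\frac{1}{zd_\mu}\right)^{\widetilde\lambda_\mu}},$$ where $C\in\mathbb{C}$, $B\in\mathbb{R}$, $A,A_0\ge 0$, and $a_\nu,b_\mu,c_\nu,d_\mu,\kappa_\nu,\lambda_\mu,\widetilde\kappa_\nu,\widetilde\lambda_\mu$ are positive reals, with $W(z)\not\equiv e^Cz^B$. Let $\alpha\in\mathbb{C}\setminus\{0\}$ and $z_1,z_2\in\overline{\mathbb{C}_+}$. If $|z_1|<|z_2|$, $W(z_1)=\alpha$ and $W(z_2)=\alpha e^{i\theta}$ with a real $\theta>0$, then for every $\varrho\in(0,\theta)$ there exists $z_*\in C_{12}:=\{z\in\overline{\mathbb{C}_+}:|z_1|<|z|<|z_2|\}$ such that $W(z_* )=\alpha e^{i\varrho}$, unless the following hold simultaneously: $\theta\equiv 0\pmod{2\pi}$, both $z_1$ and $z_2$ are real of the same sign, and $|W(z)|\ne|\alpha|$ in the semi-annulus $C_{12}$.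
   Context: $\mathbb{C}_+=\{z\in\mathbb{C}:\Im z>0\}$ and $\overline{\mathbb{C}_+}$ is its closure. The products may be finite, infinite or empty and are absolutely convergent ($\sum\kappa_\nu/a_\nu$, $\sum\lambda_\mu/b_\mu$, $\sum\widetilde\kappa_\nu/c_\nu$, $\sum\widetilde\lambda_\mu/d_\mu<\infty$), and each of the sequences $(a_\nu),(b_\mu),(c_\nu),(d_\mu)$ is finite or tends to $+\infty$. $W$ is considered as a fixed single-valued holomorphic branch in $\mathbb{C}_+$, extended from $\mathbb{C}_+$ to the real points at which it is finite.
   Formalization: The real θ>0 is additionally required to satisfy θ≤2π, or else the increment of a continuous arg W from z_1 to z_2 must exceed 2π; for arbitrary θ the claim fails (W=e^z, z_1=i, z_2=2i, θ=1+2π, ϱ=2). *)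

theory Defs
  imports "HOL-Analysis.Analysis" "HOL-Library.Real_Mod"
begin

definition uhp :: "complex set" where
  "uhp = {z. Im z > 0}"

(* A finite, infinite or empty sequence is a family over an index set I of naturals; for infinite I
   the filter below is "\<nu> tends to infinity within I". The summability is that of
   \<Sum> \<kappa>\<^sub>\<nu> / a\<^sub>\<nu>. *)
definition admissible :: "nat set \<Rightarrow> (nat \<Rightarrow> real) \<Rightarrow> (nat \<Rightarrow> real) \<Rightarrow> bool" where
  "admissible I a \<kappa> \<longleftrightarrow>
     (\<forall>\<nu>\<in>I. a \<nu> > 0 \<and> \<kappa> \<nu> > 0) \<and>
     (finite I \<or> filterlim a at_top (inf sequentially (principal I))) \<and>
     (\<lambda>\<nu>. \<kappa> \<nu> / a \<nu>) summable_on I"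

(* powr is the principal power. On uhp none of z, 1 + z/a, 1 - z/b, 1 + 1/(z c), 1 - 1/(z d)
   (a, b, c, d > 0) is real, so there all the powers formed from them are holomorphic. Any other
   choice of branches for which the product converges changes it by a constant unimodular factor
   only, which is absorbed by the arbitrary complex constant C in exp C. *)
definition power_prod :: "nat set \<Rightarrow> (nat \<Rightarrow> real) \<Rightarrow> (nat \<Rightarrow> complex) \<Rightarrow> complex" where
  "power_prod I \<kappa> w = (\<Prod>\<nu>. if \<nu> \<in> I then w \<nu> powr complex_of_real (\<kappa> \<nu>) else 1)"

definition finite_points :: "(complex \<Rightarrow> complex) \<Rightarrow> complex set" where
  "finite_points W = uhp \<union> {x. Im x = 0 \<and> (\<exists>w. (W \<longlongrightarrow> w) (at x within uhp))}"

(* arg_gain W z1 z2 \<delta>: the increment from z1 to z2 of a continuous branch of arg W over uhp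
   is \<delta>. Here L is a branch of log W; the end points may be real, whence the limits. The increment
   does not depend on the branch. *)
definition arg_gain :: "(complex \<Rightarrow> complex) \<Rightarrow> complex \<Rightarrow> complex \<Rightarrow> real \<Rightarrow> bool" where
  "arg_gain W z1 z2 \<delta> \<longleftrightarrow>
     (\<exists>L l1 l2. continuous_on uhp L \<and> (\<forall>z\<in>uhp. exp (L z) = W z) \<and>
        (L \<longlongrightarrow> l1) (at z1 within uhp) \<and> (L \<longlongrightarrow> l2) (at z2 within uhp) \<and>
        \<delta> = Im l2 - Im l1)"

(* The values of W determine \<theta> modulo 2 pi only. A representative beyond a full turn is meant
   only if arg W really makes more than a full turn between z1 and z2; otherwise W would have to
   attain values on parts of the circle that it does not reach: for W z = exp z, z1 = \<i>,
   z2 = 2 \<i>, one has \<theta> = 1 modulo 2 pi, and with \<theta> = 1 + 2 pi only the values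
   with \<rho> in (0, 1) (modulo 2 pi) are attained for 1 < |z| < 2. *)
definition admissible_angle ::
    "(complex \<Rightarrow> complex) \<Rightarrow> complex \<Rightarrow> complex \<Rightarrow> real \<Rightarrow> bool" where
  "admissible_angle W z1 z2 \<theta> \<longleftrightarrow>
     0 < \<theta> \<and> (\<theta> \<le> 2 * pi \<or> (\<exists>\<delta>. arg_gain W z1 z2 \<delta> \<and> 2 * pi < \<delta>))"

definition semi_annulus :: "complex \<Rightarrow> complex \<Rightarrow> complex set" where
  "semi_annulus z1 z2 = {z \<in> closure uhp. norm z1 < norm z \<and> norm z < norm z2}"

end

(*
In the logarithmic variable z \<mapsto> exp z the half-plane becomes the strip 0 < Im z < pi, and W (exp z) = exp (F z),
where F is a sum of an affine function, positive multiples of exp z, exp (-z), and terms such as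
Ln (1 + exp z / a). On the strip F' maps into the upper half-plane, so that
Im ((F n - F z) / (n - z)) > 0 unless z and n are on the same boundary line. Consequently Re F is strictly decreasing on
every vertical segment, a level set {Re F = l} is a graph over the real axis, and Im F increases along it.
Where the level set leaves the strip, the graph is continued along the boundary lines; there
Im F is locally constant off the singularities, and the graph avoids these since
Re F tends to +\<infinity> (below) or -\<infinity> (above). The intermediate value theorem for Im F along the graph
gives the points z_*. If both end points are on one boundary line, the strict convexity of Re F between singularities
on the lower line (concavity on the upper one) makes the increment of Im F positive as soon as |W| takes the value |\<alpha>|
in between.
*)
theory Submission
  imports Defs
begin

section \<open>Functions on the strip\<close>

text \<open>Difference quotients are used instead of derivatives because their imaginary parts add
  up under convergent series without termwise differentiation and keep their sign, though not
  strictness, in the limit at boundary points. The sign comes from the single factors: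
  \<open>exp z\<close> lies in the upper half-plane for z in the strip, and so does w / (a + w) when
  w does and a > 0. The remaining kinds of factors arise from \<open>Ln (1 + exp z / a)\<close> by
  reflecting the strip in its middle line or in the imaginary axis. The affine part, which stands
  for exp C z^B, has a real quotient; hence strictness is tracked by a flag, and W must not reduce
  to that part. Two configurations escape the quotients. For two points of one boundary line with no
  singularity between them the quotient is real, which leaves only convexity of \<open>Re F\<close>
  and leads to the exceptional case. The point z = 0 has no preimage in the strip and is replaced by
  a limit at its left end. Finally, exp forgets full turns, so the increment of \<open>Im F\<close>
  still has to be compared with \<theta>.\<close>

definition open_strip :: "complex set" where
  "open_strip = {z. 0 < Im z \<and> Im z < pi}"

text \<open>\<open>P\<close> and \<open>Q\<close> are the real parts of the singularities on the lower and the upper boundary line.\<close>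

definition strip_reg :: "real set \<Rightarrow> real set \<Rightarrow> complex set" where
  "strip_reg P Q = {z. 0 \<le> Im z \<and> Im z \<le> pi \<and> (Im z = 0 \<longrightarrow> Re z \<notin> P) \<and> (Im z = pi \<longrightarrow> Re z \<notin> Q)}"

text \<open>The reflection in the line \<open>Im z = pi / 2\<close> with a sign that preserves \<open>Im F\<close>; it exchanges the two
  boundary lines, so that only the lower one has to be studied.\<close>

definition refl_strip :: "(complex \<Rightarrow> complex) \<Rightarrow> complex \<Rightarrow> complex" where
  "refl_strip F z = - cnj (F (cnj z + \<i> * of_real pi))"

text \<open>The flag \<open>st\<close> says that the inequalities are strict. All the conditions are additive in \<open>F\<close>;
  convexity of \<open>Re F\<close> is stated through slopes for that reason.\<close>

definition bottom_ok :: "bool \<Rightarrow> (complex \<Rightarrow> complex) \<Rightarrow> real set \<Rightarrow> bool" where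
  "bottom_ok st F P \<longleftrightarrow>
     closed P \<and>
     continuous_on {z. 0 \<le> Im z \<and> Im z < pi \<and> (Im z = 0 \<longrightarrow> Re z \<notin> P)} F \<and>
     (\<forall>x y. x \<le> y \<and> {x..y} \<inter> P = {} \<longrightarrow> Im (F (of_real x)) = Im (F (of_real y))) \<and>
     (\<forall>x m y. x < m \<and> m < y \<and> {x..y} \<inter> P = {} \<longrightarrow>
        (let d = Re (F (of_real y) - F (of_real m)) / (y - m) - Re (F (of_real m) - F (of_real x)) / (m - x)
         in 0 \<le> d \<and> (st \<longrightarrow> 0 < d))) \<and>
     (\<forall>p\<in>P. filterlim (\<lambda>h. Re (F (Complex p h))) at_top (at_right 0))"

definition strip_map :: "bool \<Rightarrow> (complex \<Rightarrow> complex) \<Rightarrow> real set \<Rightarrow> real set \<Rightarrow> bool" where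
  "strip_map st F P Q \<longleftrightarrow>
     bottom_ok st F P \<and> bottom_ok st (refl_strip F) Q \<and>
     (\<forall>z\<in>open_strip. \<forall>n\<in>open_strip. z \<noteq> n \<longrightarrow>
        0 \<le> Im ((F n - F z) / (n - z)) \<and> (st \<longrightarrow> 0 < Im ((F n - F z) / (n - z))))"

lemma refl_refl [simp]: "refl_strip (refl_strip F) = F"
  by (auto simp: refl_strip_def fun_eq_iff)

lemma refl_strip_Complex: "refl_strip F (Complex x h) = - cnj (F (Complex x (pi - h)))"
proof -
  have "cnj (Complex x h) + \<i> * of_real pi = Complex x (pi - h)"
    by (auto simp: complex_eq_iff)
  then show ?thesis by (simp add: refl_strip_def)
qed

text \<open>The map z -> cnj z + i pi together with the sign in \<open>refl_strip\<close> turns a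
  difference quotient q into - cnj q, which has the same imaginary part; the two boundary clauses
  merely trade places.\<close>

lemma strip_map_refl:
  assumes "strip_map st F P Q"
  shows "strip_map st (refl_strip F) Q P"
proof -
  have "0 \<le> Im ((refl_strip F n - refl_strip F z) / (n - z)) \<and>
      (st \<longrightarrow> 0 < Im ((refl_strip F n - refl_strip F z) / (n - z)))"
    if "z \<in> open_strip" "n \<in> open_strip" "z \<noteq> n" for z n
  proof -
    let ?z = "cnj z + \<i> * of_real pi" and ?n = "cnj n + \<i> * of_real pi"
    have "?z \<in> open_strip" "?n \<in> open_strip" "?z \<noteq> ?n"
      using that by (auto simp: open_strip_def)
    then have *: "0 \<le> Im ((F ?n - F ?z) / (?n - ?z)) \<and> (st \<longrightarrow> 0 < Im ((F ?n - F ?z) / (?n - ?z)))"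
      using assms unfolding strip_map_def by blast
    have "(refl_strip F n - refl_strip F z) / (n - z) = - cnj ((F ?n - F ?z) / (?n - ?z))"
    proof -
      have "cnj (?n - ?z) = n - z" by simp
      moreover have "refl_strip F n - refl_strip F z = - cnj (F ?n - F ?z)"
        by (simp add: refl_strip_def)
      ultimately show ?thesis by (metis complex_cnj_divide minus_divide_left)
    qed
    then have "Im ((refl_strip F n - refl_strip F z) / (n - z)) = Im ((F ?n - F ?z) / (?n - ?z))"
      by (simp only: uminus_complex.sel cnj.sel minus_minus)
    then show ?thesis using * by simp
  qed
  with assms show ?thesis by (simp add: strip_map_def)
qed

text \<open>Continuity is known below the upper line directly, and above the lower line after
  reflection. Both pieces are relatively open in their union, so the statements glue.\<close>

lemma strip_map_continuous:
  assumes "strip_map st F P Q"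
  shows "continuous_on (strip_reg P Q) F"
proof -
  let ?U = "\<lambda>P. {z. 0 \<le> Im z \<and> Im z < pi \<and> (Im z = 0 \<longrightarrow> Re z \<notin> P)}"
  let ?V = "{z. 0 < Im z \<and> Im z \<le> pi \<and> (Im z = pi \<longrightarrow> Re z \<notin> Q)}"
  have U: "continuous_on (?U P) F"
    using assms by (auto simp: strip_map_def bottom_ok_def)
  have R: "continuous_on (?U Q) (refl_strip F)"
    using assms by (auto simp: strip_map_def bottom_ok_def)
  have "continuous_on ?V (\<lambda>z. - cnj (refl_strip F (cnj z + \<i> * of_real pi)))"
    by (intro continuous_intros continuous_on_compose2[OF R]) auto
  moreover have "(\<lambda>z. - cnj (refl_strip F (cnj z + \<i> * of_real pi))) = F"
    by (auto simp: refl_strip_def)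
  ultimately have V: "continuous_on ?V F" by metis
  have eq: "strip_reg P Q = ?U P \<union> ?V" by (auto simp: strip_reg_def)
  have oU: "openin (top_of_set (?U P \<union> ?V)) (?U P)"
    unfolding openin_open
    by (intro exI[of _ "{z. Im z < pi}"] conjI open_halfspace_Im_lt) auto
  have oV: "openin (top_of_set (?U P \<union> ?V)) ?V"
    unfolding openin_open
    by (intro exI[of _ "{z. Im z > 0}"] conjI open_halfspace_Im_gt) auto
  show ?thesis unfolding eq using continuous_on_Un_local_open[OF oU oV U V] .
qed

lemma open_strip_subset_reg: "open_strip \<subseteq> strip_reg P Q"
  by (auto simp: open_strip_def strip_reg_def)

text \<open>Boundary points are approached along segments towards the centre of the strip.\<close>

lemma quotient_Im_nonneg:
  assumes sm: "strip_map st F P Q" and z: "z \<in> strip_reg P Q" and n: "n \<in> strip_reg P Q" and "z \<noteq> n"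
  shows "0 \<le> Im ((F n - F z) / (n - z))"
proof -
  \<comment> \<open>Both points are moved by the same homothety, so distinct points stay distinct.
    The shift by 2 keeps \<open>e k < 1\<close> already for \<open>k = 0\<close>.\<close>
  define e where "e k = 1 / (real k + 2)" for k
  have e: "0 < e k" "e k < 1" for k by (auto simp: e_def)
  have e0: "e \<longlonglongrightarrow> 0" 

    using LIMSEQ_ignore_initial_segment[OF LIMSEQ_inverse_real_of_nat, of 1]
    unfolding e_def by (simp add: inverse_eq_divide add.commute)
  define s where "s k z = (1 - of_real (e k)) * z + of_real (e k) * Complex 0 (pi/2)" for k z
  have s_in: "s k w \<in> open_strip" if "w \<in> strip_reg P Q" for k w
  proof -
    have "Im (s k w) = (1 - e k) * Im w + e k * (pi/2)" by (simp add: s_def)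
    moreover have "0 \<le> (1 - e k) * Im w" "(1 - e k) * Im w \<le> (1 - e k) * pi"
      using e[of k] that by (auto simp: strip_reg_def)
    moreover have "0 < e k * pi" using e[of k] by simp
    ultimately show ?thesis by (simp add: open_strip_def algebra_simps)
  qed
  have s_lim: "(\<lambda>k. s k w) \<longlonglongrightarrow> w" for w
  proof -
    have "(\<lambda>k. s k w) \<longlonglongrightarrow> (1 - of_real 0) * w + of_real 0 * Complex 0 (pi/2)"
      unfolding s_def by (intro tendsto_intros e0)
    then show ?thesis by simp
  qed
  have F_lim: "(\<lambda>k. F (s k w)) \<longlonglongrightarrow> F w" if "w \<in> strip_reg P Q" for w
    using strip_map_continuous[OF sm] s_lim that
    by (rule continuous_on_tendsto_compose)
      (use s_in[OF that] open_strip_subset_reg in \<open>auto intro!: always_eventually\<close>)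
  have "(\<lambda>k. Im ((F (s k n) - F (s k z)) / (s k n - s k z))) \<longlonglongrightarrow> Im ((F n - F z) / (n - z))"
    using \<open>z \<noteq> n\<close> by (intro tendsto_intros F_lim s_lim z n) auto
  moreover have "0 \<le> Im ((F (s k n) - F (s k z)) / (s k n - s k z))" for k
  proof -
    have "s k n - s k z = (1 - of_real (e k)) * (n - z)" by (simp add: s_def algebra_simps)
    moreover have "1 - of_real (e k) \<noteq> (0::complex)" using e(2)[of k]
      by (metis eq_iff_diff_eq_0 less_irrefl of_real_eq_1_iff)
    ultimately have "s k z \<noteq> s k n" using \<open>z \<noteq> n\<close> by auto
    then show ?thesis using sm s_in[OF z, of k] s_in[OF n, of k] unfolding strip_map_def by blast
  qed
  ultimately show ?thesis by (intro LIMSEQ_le_const) auto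
qed

text \<open>The limit at the boundary loses strictness, so the segment is cut into thirds: the
  middle one lies in the open strip and contributes strictly, the outer ones weakly. The condition
  \<open>line\<close> is what keeps the middle third off the boundary.\<close>

lemma quotient_Im_pos:
  assumes sm: "strip_map True F P Q" and z: "z \<in> strip_reg P Q" and n: "n \<in> strip_reg P Q" and "z \<noteq> n"
    and line: "Im z \<noteq> Im n \<or> (0 < Im z \<and> Im z < pi)"
  shows "0 < Im ((F n - F z) / (n - z))"
proof -
  define a where "a = z + (n - z) / 3"
  define b where "b = z + 2 * (n - z) / 3"
  have "0 \<le> Im z" "Im z \<le> pi" "0 \<le> Im n" "Im n \<le> pi" using z n by (auto simp: strip_reg_def)
  then have ab: "a \<in> open_strip" "b \<in> open_strip"
    using line by (auto simp: a_def b_def open_strip_def field_simps)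
  then have ab': "a \<in> strip_reg P Q" "b \<in> strip_reg P Q" using open_strip_subset_reg by auto
  have d: "a - z = (n - z) / 3" "b - a = (n - z) / 3" "n - b = (n - z) / 3"
    by (auto simp: a_def b_def field_simps)
  have ne: "z \<noteq> a" "a \<noteq> b" "b \<noteq> n" using d \<open>z \<noteq> n\<close> by auto
  have "0 \<le> Im ((F a - F z) / (a - z))" "0 \<le> Im ((F n - F b) / (n - b))"
    using quotient_Im_nonneg[OF sm] z n ab' ne by auto
  moreover have "0 < Im ((F b - F a) / (b - a))"
    using sm ab ne unfolding strip_map_def by blast
  moreover have "(F a - F z) / (a - z) + (F b - F a) / (b - a) + (F n - F b) / (n - b)
      = 3 * ((F n - F z) / (n - z))"
  proof -
    have "p / (D / 3) + q / (D / 3) + r / (D / 3) = 3 * ((p + q + r) / D)" for p q r D :: complex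
      by (simp add: add_divide_distrib algebra_simps)
    note this[of "F a - F z" "n - z" "F b - F a" "F n - F b"]
    moreover have "F a - F z + (F b - F a) + (F n - F b) = F n - F z" by simp
    ultimately show ?thesis unfolding d by metis
  qed
  then have "Im ((F a - F z) / (a - z)) + Im ((F b - F a) / (b - a)) + Im ((F n - F b) / (n - b))
      = 3 * Im ((F n - F z) / (n - z))"
    by (metis Im_complex_of_real Re_complex_of_real add.right_neutral mult_zero_left of_real_numeral
        plus_complex.sel(2) times_complex.sel(2))
  ultimately show ?thesis by linarith
qed

text \<open>For a vertical step the denominator is i t with t > 0, and the imaginary part of w / (i
  t) is - Re w / t.\<close>

lemma Re_decreasing:
  assumes sm: "strip_map True F P Q" and "Complex s h1 \<in> strip_reg P Q" "Complex s h2 \<in> strip_reg P Q"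
    and "h1 < h2"
  shows "Re (F (Complex s h2)) < Re (F (Complex s h1))"
proof -
  have "0 < Im ((F (Complex s h2) - F (Complex s h1)) / (Complex s h2 - Complex s h1))"
    using assms by (intro quotient_Im_pos[OF sm]) auto
  moreover have "Complex s h2 - Complex s h1 = \<i> * of_real (h2 - h1)" by (simp add: complex_eq_iff)
  ultimately show ?thesis using \<open>h1 < h2\<close>
    by (simp add: Im_divide divide_less_0_iff zero_less_divide_iff power2_eq_square mult_less_0_iff)
qed

text \<open>With equal real parts the numerator is purely imaginary, so the imaginary part of the
  quotient is the increment of \<open>Im F\<close> times (Re n - Re z) / |n - z|^2.\<close>

lemma
  assumes sm: "strip_map True F P Q" and z: "z \<in> strip_reg P Q" and n: "n \<in> strip_reg P Q"
    and lt: "Re z < Re n" and eq: "Re (F z) = Re (F n)"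
  shows Im_mono: "Im (F z) \<le> Im (F n)"
    and Im_strict_mono: "Im z \<noteq> Im n \<or> (0 < Im z \<and> Im z < pi) \<Longrightarrow> Im (F z) < Im (F n)"
proof -
  have "z \<noteq> n" using lt by auto
  have q: "Im ((F n - F z) / (n - z)) = (Im (F n) - Im (F z)) * ((Re n - Re z) / (cmod (n - z))\<^sup>2)"
    using eq by (simp add: Im_divide cmod_power2)
  have p: "0 < (Re n - Re z) / (cmod (n - z))\<^sup>2" using lt \<open>z \<noteq> n\<close> by simp
  show "Im (F z) \<le> Im (F n)"
    using quotient_Im_nonneg[OF sm z n \<open>z \<noteq> n\<close>] p unfolding q by (meson diff_ge_0_iff_ge not_less zero_le_mult_iff)
  show "Im (F z) < Im (F n)" if "Im z \<noteq> Im n \<or> (0 < Im z \<and> Im z < pi)"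
    using quotient_Im_pos[OF sm z n \<open>z \<noteq> n\<close> that] p unfolding q by (meson diff_gt_0_iff_gt less_asym zero_less_mult_iff)
qed

text \<open>The ordinate of the level set above s, clipped to the strip: 0 if \<open>Re F\<close>
  stays below l on the open vertical segment, pi if it stays above. Adjoining 0 keeps the set
  nonempty in the first case.\<close>

definition height :: "(complex \<Rightarrow> complex) \<Rightarrow> real \<Rightarrow> real \<Rightarrow> real" where
  "height F l s = Sup ({0} \<union> {h. 0 < h \<and> h < pi \<and> l < Re (F (Complex s h))})"

lemma height_bounds: "0 \<le> height F l s" "height F l s \<le> pi"
proof -
  let ?S = "{0} \<union> {h. 0 < h \<and> h < pi \<and> l < Re (F (Complex s h))}"
  have "bdd_above ?S" by (rule bdd_aboveI[of _ pi]) auto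
  then show "0 \<le> height F l s" unfolding height_def by (intro cSup_upper) auto
  show "height F l s \<le> pi" unfolding height_def by (intro cSup_least) auto
qed

lemma Complex_open_strip [simp]: "Complex s h \<in> open_strip \<longleftrightarrow> 0 < h \<and> h < pi"
  by (auto simp: open_strip_def)

lemma Complex_reg: "0 < h \<Longrightarrow> h < pi \<Longrightarrow> Complex s h \<in> strip_reg P Q"
  by (auto simp: strip_reg_def)

lemma strip_cont_at:
  assumes "strip_map st F P Q" "z \<in> open_strip" shows "isCont F z"
proof -
  have "open open_strip" unfolding open_strip_def
    by (intro open_Collect_conj open_halfspace_Im_gt open_halfspace_Im_lt)
  moreover have "continuous_on open_strip F"
    using strip_map_continuous[OF assms(1)] open_strip_subset_reg continuous_on_subset by blast
  ultimately show ?thesis using assms(2) continuous_on_eq_continuous_at by blast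
qed

text \<open>Being above the level propagates downwards by monotonicity and, by continuity, also
  slightly upwards, so such an h is never the supremum itself.\<close>

lemma less_height_iff:
  assumes sm: "strip_map True F P Q" and h: "0 < h" "h < pi"
  shows "h < height F l s \<longleftrightarrow> l < Re (F (Complex s h))"
proof
  let ?S = "{0} \<union> {h. 0 < h \<and> h < pi \<and> l < Re (F (Complex s h))}"
  have bdd: "bdd_above ?S" by (rule bdd_aboveI[of _ pi]) auto
  {
    assume "h < height F l s"
    then obtain h' where "h' \<in> ?S" "h < h'"
      unfolding height_def by (subst (asm) less_cSup_iff[OF _ bdd]) auto
    then have "h' < pi" "l < Re (F (Complex s h'))" using h by auto
    then show "l < Re (F (Complex s h))"
      using Re_decreasing[OF sm, of s h h'] h \<open>h < h'\<close> Complex_reg by force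
  }
  assume l: "l < Re (F (Complex s h))"
  have "isCont (\<lambda>h. Re (F (Complex s h))) h"
  proof -
    have "isCont F (Complex s h)" using strip_cont_at[OF sm] h by simp
    moreover have "isCont (\<lambda>h. Complex s h) h" unfolding Complex_eq by (intro continuous_intros)
    ultimately show ?thesis using isCont_o2 continuous_Re by metis
  qed
  then have "((\<lambda>h. Re (F (Complex s h))) \<longlongrightarrow> Re (F (Complex s h))) (at_right h)"
    unfolding isCont_def by (rule filterlim_mono) (auto simp: at_le)
  then have "eventually (\<lambda>h. l < Re (F (Complex s h))) (at_right h)" using l by (rule order_tendstoD)
  moreover have "eventually (\<lambda>h'. h < h' \<and> h' < pi) (at_right h)"
    using h eventually_at_right by blast
  ultimately have "eventually (\<lambda>h'. l < Re (F (Complex s h')) \<and> h < h' \<and> h' < pi) (at_right h)"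
    by (rule eventually_conj)
  from eventually_happens'[OF trivial_limit_at_right_real this]
  obtain h' where "l < Re (F (Complex s h'))" "h < h'" "h' < pi" by blast
  then have "h' \<in> ?S" using h by auto
  then have "h' \<le> height F l s" unfolding height_def by (intro cSup_upper bdd)
  then show "h < height F l s" using \<open>h < h'\<close> by simp
qed

text \<open>More than the negation of the previous equivalence, since equality has to be excluded in
  both directions: by strict decrease between a midpoint and h in one, by continuity from below in
  the other.\<close>

lemma height_less_iff:
  assumes sm: "strip_map True F P Q" and h: "0 < h" "h < pi"
  shows "height F l s < h \<longleftrightarrow> Re (F (Complex s h)) < l"
proof
  assume a: "height F l s < h"
  define k where "k = (height F l s + h) / 2"
  have k: "height F l s < k" "k < h" "0 < k" "k < pi"
    using a h height_bounds[of F l s] by (auto simp: k_def)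
  then have "\<not> l < Re (F (Complex s k))" using less_height_iff[OF sm k(3,4), of l s] by simp
  moreover have "Re (F (Complex s h)) < Re (F (Complex s k))"
    using Re_decreasing[OF sm _ _ \<open>k < h\<close>] k h Complex_reg by auto
  ultimately show "Re (F (Complex s h)) < l" by simp
next
  assume a: "Re (F (Complex s h)) < l"
  then have "height F l s \<le> h" using less_height_iff[OF sm h, of l s] by simp
  moreover have "height F l s \<noteq> h"
  proof
    assume e: "height F l s = h"
    have "isCont (\<lambda>h. Re (F (Complex s h))) h"
    proof -
      have "isCont F (Complex s h)" using strip_cont_at[OF sm] h by simp
      moreover have "isCont (\<lambda>h. Complex s h) h" unfolding Complex_eq by (intro continuous_intros)
      ultimately show ?thesis using isCont_o2 continuous_Re by metis
    qed
    then have "((\<lambda>h. Re (F (Complex s h))) \<longlongrightarrow> Re (F (Complex s h))) (at_left h)"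
      unfolding isCont_def by (rule filterlim_mono) (auto simp: at_le)
    then have "eventually (\<lambda>h. Re (F (Complex s h)) < l) (at_left h)" using a by (rule order_tendstoD)
    moreover have "eventually (\<lambda>h'. 0 < h' \<and> h' < h) (at_left h)"
      using h eventually_at_left by blast
    ultimately have "eventually (\<lambda>h'. Re (F (Complex s h')) < l \<and> 0 < h' \<and> h' < h) (at_left h)"
      by (rule eventually_conj)
    from eventually_happens'[OF trivial_limit_at_left_real this]
    obtain h' where "Re (F (Complex s h')) < l" "0 < h'" "h' < h" by blast
    then show False using less_height_iff[OF sm, of h' l s] e h by auto
  qed
  ultimately show "height F l s < h" by simp
qed

section \<open>Level curves of the real part\<close>

text \<open>The comparisons above hold only at interior heights, while z may lie on the boundary. A
  midpoint between the height and \<open>Im z\<close> is interior, and strict decrease links it to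
  z.\<close>

lemma height_eq:
  assumes sm: "strip_map True F P Q" and z: "z \<in> strip_reg P Q" and l: "Re (F z) = l"
  shows "height F l (Re z) = Im z"
proof (rule ccontr)
  assume ne: "height F l (Re z) \<noteq> Im z"
  define k where "k = (height F l (Re z) + Im z) / 2"
  have b: "0 \<le> Im z" "Im z \<le> pi" using z by (auto simp: strip_reg_def)
  have zc: "Complex (Re z) (Im z) \<in> strip_reg P Q" using z by simp
  show False
  proof (cases "height F l (Re z) < Im z")
    case True
    then have k: "0 < k" "k < pi" "height F l (Re z) < k" "k < Im z"
      using b height_bounds[of F l "Re z"] by (auto simp: k_def)
    then show False
      using Re_decreasing[OF sm Complex_reg[OF k(1,2)] zc k(4)] height_less_iff[OF sm k(1,2), of l "Re z"] l
      by simp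
  next
    case False
    then have k: "0 < k" "k < pi" "k < height F l (Re z)" "Im z < k"
      using ne b height_bounds[of F l "Re z"] by (auto simp: k_def)
    then show False
      using Re_decreasing[OF sm zc Complex_reg[OF k(1,2)] k(4)] less_height_iff[OF sm k(1,2), of l "Re z"] l
      by simp
  qed
qed

lemma Re_at_height:
  assumes sm: "strip_map True F P Q" and h: "0 < height F l s" "height F l s < pi"
  shows "Re (F (Complex s (height F l s))) = l"
  using less_height_iff[OF sm h, of l s] height_less_iff[OF sm h, of l s] by simp

text \<open>At a fixed interior h, being above or below h is an open condition on s, since it is a
  strict inequality for \<open>Re (F (Complex s h))\<close>, which is continuous in s.\<close>

lemma continuous_height:
  assumes sm: "strip_map True F P Q"
  shows "continuous_on UNIV (height F l)"
proof -
  have cF: "isCont (\<lambda>s. Re (F (Complex s h))) s" if "0 < h" "h < pi" for s h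
  proof -
    have "isCont F (Complex s h)" using strip_cont_at[OF sm] that by simp
    moreover have "isCont (\<lambda>s. Complex s h) s" unfolding Complex_eq by (intro continuous_intros)
    ultimately show ?thesis using isCont_o2 continuous_Re by metis
  qed
  have ev: "eventually (\<lambda>s'. y < height F l s') (at s)"
    if y: "y < height F l s" for y s
  proof -
    \<comment> \<open>The bound y may lie outside the strip; clipping it makes the midpoint h
      interior.\<close>
    define h where "h = (max 0 y + height F l s) / 2"
    show ?thesis
    proof (cases "y < 0")
      case True
      then show ?thesis using height_bounds(1) less_le_trans by (intro always_eventually) blast
    next
      case False
      then have h: "0 < h" "h < pi" "y < h" "h < height F l s"
        using y height_bounds[of F l s] by (auto simp: h_def)
      then have "l < Re (F (Complex s h))" using less_height_iff[OF sm h(1,2)] by simp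
      then have "eventually (\<lambda>s. l < Re (F (Complex s h))) (at s)"
        using cF[OF h(1,2), of s] order_tendstoD(1) unfolding isCont_def by blast
      then show ?thesis
      proof eventually_elim
        case (elim t)
        then have "h < height F l t" using less_height_iff[OF sm h(1,2)] by simp
        then show ?case using h(3) by simp
      qed
    qed
  qed
  have ev': "eventually (\<lambda>s'. height F l s' < y) (at s)"
    if y: "height F l s < y" for y s
  proof -
    define h where "h = (min pi y + height F l s) / 2"
    show ?thesis
    proof (cases "pi < y")
      case True
      then show ?thesis using height_bounds(2) le_less_trans by (intro always_eventually) blast
    next
      case False
      then have h: "0 < h" "h < pi" "h < y" "height F l s < h"
        using y height_bounds[of F l s] by (auto simp: h_def)
      then have "Re (F (Complex s h)) < l" using height_less_iff[OF sm h(1,2)] by simp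
      then have "eventually (\<lambda>s. Re (F (Complex s h)) < l) (at s)"
        using cF[OF h(1,2), of s] order_tendstoD(2) unfolding isCont_def by blast
      then show ?thesis
      proof eventually_elim
        case (elim t)
        then have "height F l t < h" using height_less_iff[OF sm h(1,2)] by simp
        then show ?case using h(3) by simp
      qed
    qed
  qed
  show ?thesis
    unfolding continuous_on_eq_continuous_at[OF open_UNIV] isCont_def
    by (auto intro!: order_tendstoI ev ev')
qed

text \<open>Runs along the clipped curve: at height 0 or pi the point need not lie on the level
  set.\<close>

definition level_pt :: "(complex \<Rightarrow> complex) \<Rightarrow> real \<Rightarrow> real \<Rightarrow> complex" where
  "level_pt F l s = Complex s (height F l s)"

lemma bottom_blowup:
  assumes "strip_map st F P Q" "p \<in> P"
  shows "filterlim (\<lambda>h. Re (F (Complex p h))) at_top (at_right 0)"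
  using assms by (auto simp: strip_map_def bottom_ok_def)

text \<open>The blow-up supplies interior points with \<open>Re F\<close> above l, whatever l
  is.\<close>

lemma height_pos_at_pole:
  assumes sm: "strip_map True F P Q" and p: "s \<in> P"
  shows "0 < height F l s"
proof -
  have "eventually (\<lambda>h. l < Re (F (Complex s h))) (at_right 0)"
    using bottom_blowup[OF sm p] by (simp add: filterlim_at_top_dense)
  moreover have "eventually (\<lambda>h. 0 < h \<and> h < pi) (at_right (0::real))"
    using pi_gt_zero eventually_at_right by blast
  ultimately have "eventually (\<lambda>h. l < Re (F (Complex s h)) \<and> 0 < h \<and> h < pi) (at_right 0)"
    by (rule eventually_conj)
  from eventually_happens'[OF trivial_limit_at_right_real this]
  obtain h where "l < Re (F (Complex s h))" "0 < h" "h < pi" by blast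
  then show ?thesis using less_height_iff[OF sm, of h l s] by simp
qed

text \<open>The supremum in \<open>height\<close> is not visibly symmetric, so both sides are
  compared through their strict inequalities with interior h. Two distinct values in [0, pi] would
  have an interior midpoint.\<close>

lemma height_refl:
  assumes sm: "strip_map True F P Q"
  shows "height (refl_strip F) (- l) s = pi - height F l s"
proof -
  note sm' = strip_map_refl[OF sm]
  have iff: "h < height (refl_strip F) (- l) s \<longleftrightarrow> h < pi - height F l s" if "0 < h" "h < pi" for h
    using less_height_iff[OF sm' that, of "-l" s] height_less_iff[OF sm, of "pi - h" l s] that
    by (auto simp: refl_strip_Complex)
  have bounds: "0 \<le> height (refl_strip F) (- l) s" "height (refl_strip F) (- l) s \<le> pi"
    "0 \<le> pi - height F l s" "pi - height F l s \<le> pi"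
    using height_bounds[of F l s] height_bounds[of "refl_strip F" "-l" s] by auto
  show ?thesis
  proof (rule ccontr)
    assume ne: "\<not> ?thesis"
    define h where "h = (height (refl_strip F) (- l) s + (pi - height F l s)) / 2"
    have "0 < h" "h < pi" using ne bounds by (auto simp: h_def)
    from iff[OF this] show False using ne unfolding h_def by auto
  qed
qed

lemma level_pt_reg:
  assumes sm: "strip_map True F P Q"
  shows "level_pt F l s \<in> strip_reg P Q"
proof -
  have "s \<notin> Q" if "height F l s = pi"
    using height_pos_at_pole[OF strip_map_refl[OF sm], of s "-l"] height_refl[OF sm, of l s] that by auto
  then show ?thesis
    using height_pos_at_pole[OF sm, of s l] height_bounds[of F l s]
    by (auto simp: strip_reg_def level_pt_def)
qed

lemma level_pt_eq:
  assumes sm: "strip_map True F P Q" and z: "z \<in> strip_reg P Q" and l: "Re (F z) = l"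
  shows "level_pt F l (Re z) = z"
  using height_eq[OF assms] by (simp add: level_pt_def)

lemma continuous_level_pt:
  assumes sm: "strip_map True F P Q"
  shows "continuous_on UNIV (\<lambda>s. F (level_pt F l s))"
proof (rule continuous_on_compose2[OF strip_map_continuous[OF sm]])
  show "continuous_on UNIV (level_pt F l)"
    unfolding level_pt_def Complex_eq by (intro continuous_intros continuous_height[OF sm])
qed (use level_pt_reg[OF sm] in auto)

lemma bottom_Im_locally_const:
  assumes sm: "strip_map st F P Q" and s: "s \<notin> P"
  shows "eventually (\<lambda>s'. s' \<notin> P \<and> Im (F (Complex s' 0)) = Im (F (Complex s 0))) (nhds s)"
proof -
  have cl: "closed P" and const: "\<And>x y. x \<le> y \<Longrightarrow> {x..y} \<inter> P = {} \<Longrightarrow> Im (F (Complex x 0)) = Im (F (Complex y 0))"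
    using sm by (auto simp: strip_map_def bottom_ok_def complex_of_real_def)
  have "open (- P)" using cl by blast
  then obtain e where e: "e > 0" "ball s e \<subseteq> - P" using s open_contains_ball by blast
  have "s' \<notin> P \<and> Im (F (Complex s' 0)) = Im (F (Complex s 0))" if "dist s' s < e" for s'
  proof -
    have "{min s s'..max s s'} \<subseteq> ball s e" using that by (auto simp: dist_real_def)
    then have "{min s s'..max s s'} \<inter> P = {}" using e by auto
    moreover have "s' \<notin> P" using e(2) that by (auto simp: dist_commute)
    ultimately show ?thesis using const[of "min s s'" "max s s'"]
      by (cases "s \<le> s'") (auto simp: min_def max_def)
  qed
  then show ?thesis unfolding eventually_nhds_metric using e(1) by blast
qed

lemma level_pt_refl:
  assumes sm: "strip_map True F P Q"
  shows "F (level_pt F l s) = - cnj (refl_strip F (level_pt (refl_strip F) (- l) s))"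
  unfolding level_pt_def refl_strip_Complex height_refl[OF sm] by simp

text \<open>\<open>Re F\<close> differs from l at the clipped point and hence nearby, whereas at
  every interior height it equals l. So neighbouring points also sit at height 0, where
  \<open>Im F\<close> is locally constant.\<close>

lemma level_locally_const_bottom:
  assumes sm: "strip_map True F P Q" and h: "height F l s = 0" and l: "Re (F (level_pt F l s)) \<noteq> l"
  shows "eventually (\<lambda>s'. Im (F (level_pt F l s')) = Im (F (level_pt F l s))) (nhds s)"
proof -
  have sP: "s \<notin> P" using height_pos_at_pole[OF sm, of s l] h by auto
  let ?G = "\<lambda>s. F (level_pt F l s)"
  have "eventually (\<lambda>s'. Re (?G s') \<noteq> l) (nhds s)"
  proof -
    have "isCont (\<lambda>s. Re (?G s)) s"
      using continuous_level_pt[OF sm] by (intro continuous_Re) (simp add: continuous_on_eq_continuous_at)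
    then have "(\<lambda>s. Re (?G s)) \<midarrow>s\<rightarrow> Re (?G s)" by (simp add: isCont_def)
    then have "((\<lambda>s. Re (?G s)) \<longlongrightarrow> Re (?G s)) (nhds s)" by (simp add: tendsto_nhds_iff)
    then show ?thesis using l by (rule tendsto_imp_eventually_ne)
  qed
  moreover have "eventually (\<lambda>s'. height F l s' < pi) (nhds s)"
  proof -
    have "isCont (height F l) s"
      using continuous_height[OF sm] by (simp add: continuous_on_eq_continuous_at)
    then have "(height F l \<longlongrightarrow> height F l s) (nhds s)" by (simp add: isCont_def tendsto_nhds_iff)
    then show ?thesis using order_tendstoD(2) h pi_gt_zero by metis
  qed
  moreover note bottom_Im_locally_const[OF sm sP]
  ultimately show ?thesis
  proof eventually_elim
    case (elim s')
    then have "\<not> 0 < height F l s'" using Re_at_height[OF sm, of l s'] by (auto simp: level_pt_def)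
    then have "height F l s' = 0" using height_bounds(1)[of F l s'] by simp
    then show ?case using elim h by (simp add: level_pt_def)
  qed
qed

lemma level_locally_const:
  assumes sm: "strip_map True F P Q" and l: "Re (F (level_pt F l s)) \<noteq> l"
  shows "eventually (\<lambda>s'. Im (F (level_pt F l s')) = Im (F (level_pt F l s))) (nhds s)"
proof -
  consider "height F l s = 0" | "height F l s = pi"
    using Re_at_height[OF sm, of l s] l height_bounds[of F l s] by (fastforce simp: level_pt_def)
  then show ?thesis
  proof cases
    case 1
    then show ?thesis by (rule level_locally_const_bottom[OF sm _ l])
  next
    case 2
    have "eventually (\<lambda>s'. Im (refl_strip F (level_pt (refl_strip F) (- l) s')) = 
        Im (refl_strip F (level_pt (refl_strip F) (- l) s))) (nhds s)"
      using 2 l by (intro level_locally_const_bottom[OF strip_map_refl[OF sm]])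
        (simp_all add: height_refl[OF sm] level_pt_refl[OF sm, of l])
    then show ?thesis unfolding level_pt_refl[OF sm, of l] uminus_complex.sel cnj.sel minus_minus .
  qed
qed

text \<open>Where the level curve is clipped to the boundary, \<open>Im F\<close> is locally constant along it. So at
  the first parameter at which \<open>Im F\<close> takes a new value, the curve is not clipped.\<close>

lemma level_value_attained:
  assumes sm: "strip_map True F P Q" and z: "z \<in> strip_reg P Q" and n: "n \<in> strip_reg P Q"
    and lt: "Re z < Re n" and eq: "Re (F z) = l" "Re (F n) = l"
    and y: "Im (F z) < y" "y < Im (F n)"
  obtains w where "w \<in> strip_reg P Q" "Re z < Re w" "Re w < Re n" "F w = Complex l y"
proof -
  define g where "g s = Im (F (level_pt F l s))" for s
  have cg: "continuous_on UNIV g"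
    unfolding g_def using continuous_level_pt[OF sm] by (intro continuous_intros) auto
  have g1: "g (Re z) = Im (F z)" and g2: "g (Re n) = Im (F n)"
    unfolding g_def using level_pt_eq[OF sm] z n eq by auto
  let ?S = "{s \<in> {Re z..Re n}. g s = y}"
  have "\<exists>s\<ge>Re z. s \<le> Re n \<and> g s = y"
    using y g1 g2 lt by (intro IVT') (auto intro: continuous_on_subset[OF cg])
  then have ne: "?S \<noteq> {}" by auto
  have eqS: "?S = {Re z..Re n} \<inter> g -` {y}" by auto
  have "closed ({Re z..Re n} \<inter> g -` {y})"
    by (intro continuous_closed_preimage continuous_on_subset[OF cg]) auto
  then have "compact ({Re z..Re n} \<inter> ({Re z..Re n} \<inter> g -` {y}))"
    by (intro compact_Int_closed compact_Icc)
  then have "compact ?S" unfolding eqS by (simp add: Int_assoc[symmetric])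
  from compact_attains_inf[OF this ne] obtain s where s: "s \<in> ?S" "\<And>t. t \<in> ?S \<Longrightarrow> s \<le> t" by blast
  have s1: "Re z < s" "s < Re n" using s(1) g1 g2 y by (auto simp: less_le)
  have "Re (F (level_pt F l s)) = l"
  proof (rule ccontr)
    assume "Re (F (level_pt F l s)) \<noteq> l"
    from level_locally_const[OF sm this] have "eventually (\<lambda>t. g t = g s) (at_left s)"
      unfolding g_def by (rule filter_leD[OF at_within_le_nhds])
    moreover have "eventually (\<lambda>t. Re z < t \<and> t < s) (at_left s)"
      using s1 eventually_at_left by blast
    ultimately have "eventually (\<lambda>t. g t = g s \<and> Re z < t \<and> t < s) (at_left s)" by (rule eventually_conj)
    from eventually_happens'[OF trivial_limit_at_left_real this]
    obtain t where "g t = g s" "Re z < t" "t < s" by blast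
    then show False using s(1) s(2)[of t] by auto
  qed
  then have "F (level_pt F l s) = Complex l y" using s(1) by (simp add: g_def complex_eq_iff)
  then show ?thesis using that[of "level_pt F l s"] level_pt_reg[OF sm] s1 by (simp add: level_pt_def)
qed

section \<open>Increments between points of one boundary line\<close>

lemma bottom_slopes:
  assumes sm: "strip_map True F P Q" and "x < m" "m < y" "{x..y} \<inter> P = {}"
  shows "(Re (F (Complex m 0)) - Re (F (Complex x 0))) / (m - x)
       < (Re (F (Complex y 0)) - Re (F (Complex m 0))) / (y - m)"
  using assms by (auto simp: strip_map_def bottom_ok_def Let_def complex_of_real_def)

text \<open>A point of the level strictly between z and n and off the lower line splits the
  increment into two strict ones. Either the clipped curve rises and supplies such a point, or it
  stays at height 0; then no singularity intervenes, strict convexity forbids three equal values of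
  \<open>Re F\<close> on the line, and w itself is off it.\<close>

lemma bottom_gain:
  assumes sm: "strip_map True F P Q" and z: "z \<in> strip_reg P Q" and n: "n \<in> strip_reg P Q"
    and w: "w \<in> strip_reg P Q" and lt: "Re z < Re w" "Re w < Re n" and im: "Im z = 0" "Im n = 0"
    and eq: "Re (F z) = l" "Re (F w) = l" "Re (F n) = l"
  shows "Im (F z) < Im (F n)"
proof -
  have via: "Im (F z) < Im (F n)"
    if "v \<in> strip_reg P Q" "Re z < Re v" "Re v < Re n" "Re (F v) = l" "Im v \<noteq> 0" for v
  proof -
    have "Im (F z) < Im (F v)" "Im (F v) < Im (F n)"
      using that im eq by (auto intro!: Im_strict_mono[OF sm] z n)
    then show ?thesis by simp
  qed
  have hz: "height F l (Re z) = 0" and hn: "height F l (Re n) = 0"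
    using height_eq[OF sm z eq(1)] height_eq[OF sm n eq(3)] im by auto
  show ?thesis
  proof (cases "\<exists>s. Re z < s \<and> s < Re n \<and> 0 < height F l s")
    case True
    then obtain s where s: "Re z < s" "s < Re n" "0 < height F l s" by blast
    \<comment> \<open>Capping the target at pi / 2 keeps the intermediate point below the upper line
      too, so it is a genuine point of the level set.\<close>
    have "\<exists>t\<ge>Re z. t \<le> s \<and> height F l t = min (height F l s) (pi / 2)"
      using s hz by (intro IVT') (auto intro: continuous_on_subset[OF continuous_height[OF sm]])
    then obtain t where t: "Re z \<le> t" "t \<le> s" "height F l t = min (height F l s) (pi / 2)" by blast
    have th: "0 < height F l t" "height F l t < pi" using t s(3) pi_gt_zero by (auto simp: min_def)
    then have "Re z < t" using t hz by (auto simp: less_le)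
    then show ?thesis
      using via[of "level_pt F l t"] level_pt_reg[OF sm, of l t] Re_at_height[OF sm th] t(2) s(2) th(1)
      by (simp add: level_pt_def)
  next
    case False
    then have "\<not> 0 < height F l s" if "Re z \<le> s" "s \<le> Re n" for s
      using that hz hn by (cases "s = Re z"; cases "s = Re n") auto
    then have "{Re z..Re n} \<inter> P = {}" using height_pos_at_pole[OF sm] by fastforce
    from bottom_slopes[OF sm lt this]
    moreover have "Complex (Re z) 0 = z" "Complex (Re n) 0 = n" using im by (simp_all add: complex_eq_iff)
    moreover have "Complex (Re w) 0 = w" if "Im w = 0" using that by (simp add: complex_eq_iff)
    ultimately have "Im w \<noteq> 0" using eq by auto
    then show ?thesis using via[OF w lt eq(2)] by blast
  qed
qed

lemma strip_reg_refl:
  assumes "z \<in> strip_reg P Q"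
  shows "cnj z + \<i> * of_real pi \<in> strip_reg Q P"
  using assms by (auto simp: strip_reg_def)

text \<open>\<open>extra\<close> is the negation of the geometric part of the exceptional case. On
  the upper line the reflected map is used, which keeps \<open>Im F\<close> and negates the
  level.\<close>

lemma gain_pos:
  assumes sm: "strip_map True F P Q" and z: "z \<in> strip_reg P Q" and n: "n \<in> strip_reg P Q"
    and lt: "Re z < Re n" and eq: "Re (F z) = l" "Re (F n) = l"
    and extra: "Im z \<noteq> Im n \<or> (0 < Im z \<and> Im z < pi) \<or>
      (\<exists>w \<in> strip_reg P Q. Re z < Re w \<and> Re w < Re n \<and> Re (F w) = l)"
  shows "Im (F z) < Im (F n)"
proof (cases "Im z \<noteq> Im n \<or> (0 < Im z \<and> Im z < pi)")
  case True
  then show ?thesis using Im_strict_mono[OF sm z n lt] eq by simp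
next
  case False
  then obtain w where w: "w \<in> strip_reg P Q" "Re z < Re w" "Re w < Re n" "Re (F w) = l"
    using extra by blast
  consider "Im z = 0" "Im n = 0" | "Im z = pi" "Im n = pi"
    using False z by (fastforce simp: strip_reg_def)
  then show ?thesis
  proof cases
    case 1
    then show ?thesis using bottom_gain[OF sm z n w(1)] w eq by simp
  next
    case 2
    let ?r = "\<lambda>z. cnj z + \<i> * of_real pi"
    have F: "refl_strip F (?r z) = - cnj (F z)" for z by (simp add: refl_strip_def)
    have "Im (refl_strip F (?r z)) < Im (refl_strip F (?r n))"
      using 2 w eq
      by (intro bottom_gain[OF strip_map_refl[OF sm] strip_reg_refl[OF z] strip_reg_refl[OF n]
            strip_reg_refl[OF w(1)], of "-l"]) (simp_all add: F)
    then show ?thesis by (simp add: F)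
  qed
qed

section \<open>The left end of the strip\<close>

text \<open>Under exp this is a limit at the origin within the half-plane; c stands in for a value
  of F at z1 = 0.\<close>

definition left_limit :: "(complex \<Rightarrow> complex) \<Rightarrow> complex \<Rightarrow> bool" where
  "left_limit F c \<longleftrightarrow> (\<forall>e>0. \<exists>R. \<forall>w\<in>open_strip. Re w < R \<longrightarrow> dist (F w) c < e)"

lemma left_limit_refl:
  assumes "left_limit F c"
  shows "left_limit (refl_strip F) (- cnj c)"
  unfolding left_limit_def
proof (intro allI impI)
  fix e :: real assume "e > 0"
  then obtain R where R: "\<And>w. w \<in> open_strip \<Longrightarrow> Re w < R \<Longrightarrow> dist (F w) c < e"
    using assms unfolding left_limit_def by blast
  have "dist (refl_strip F w) (- cnj c) < e" if "w \<in> open_strip" "Re w < R" for w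
  proof -
    let ?v = "cnj w + \<i> * of_real pi"
    have "dist (F ?v) c < e" using that by (intro R) (auto simp: open_strip_def)
    moreover have "dist (refl_strip F w) (- cnj c) = cmod (- cnj (F ?v - c))"
      by (simp add: refl_strip_def dist_norm)
    ultimately show ?thesis by (simp only: norm_minus_cancel complex_mod_cnj dist_norm)
  qed
  then show "\<exists>R. \<forall>w\<in>open_strip. Re w < R \<longrightarrow> dist (refl_strip F w) (- cnj c) < e" by blast
qed

lemma boundary_limit:
  assumes sm: "strip_map st F P Q" and s: "s \<notin> P"
  shows "((\<lambda>h. F (Complex s h)) \<longlongrightarrow> F (Complex s 0)) (at_right 0)"
proof -
  have in_reg: "Complex s 0 \<in> strip_reg P Q" using s by (auto simp: strip_reg_def)
  have "((\<lambda>h. Complex s h) \<longlongrightarrow> Complex s 0) (at_right 0)"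
    unfolding Complex_eq by (intro tendsto_intros)
  moreover have "eventually (\<lambda>h. Complex s h \<in> strip_reg P Q) (at_right 0)"
    unfolding eventually_at_right[OF zero_less_one] using pi_gt_zero Complex_reg by blast
  ultimately show ?thesis
    using continuous_on_tendsto_compose[OF strip_map_continuous[OF sm] _ in_reg] by blast
qed

text \<open>A strictly convex function with a finite limit at \<open>-\<infinity>\<close> is increasing, so it stays above that limit.\<close>

lemma left_limit_height_pos:
  assumes sm: "strip_map True F P Q" and c: "left_limit F c"
  obtains R where "\<And>s. s < R \<Longrightarrow> 0 < height F (Re c) s"
proof -
  \<comment> \<open>The limit is given only in the open strip. It carries over to the lower line and
    excludes singularities far to the left, because \<open>Re F\<close> stays bounded there.\<close>
  have bd: "\<exists>R. \<forall>s<R. s \<notin> P \<and> dist (F (Complex s 0)) c \<le> e" if "e > 0" for e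
  proof -
    obtain R where R: "\<And>w. w \<in> open_strip \<Longrightarrow> Re w < R \<Longrightarrow> dist (F w) c < e"
      using c \<open>e > 0\<close> unfolding left_limit_def by blast
    have ev: "eventually (\<lambda>h. dist (F (Complex s h)) c < e) (at_right 0)" if "s < R" for s
      unfolding eventually_at_right[OF zero_less_one] using that
      by (intro exI[of _ pi]) (auto intro!: R)
    have "s \<notin> P" if "s < R" for s
    proof
      assume "s \<in> P"
      then have "eventually (\<lambda>h. Re c + e < Re (F (Complex s h))) (at_right 0)"
        using bottom_blowup[OF sm] by (simp add: filterlim_at_top_dense)
      from eventually_conj[OF ev[OF that] this] 
      obtain h where h: "dist (F (Complex s h)) c < e" "Re c + e < Re (F (Complex s h))"
        using eventually_happens'[OF trivial_limit_at_right_real, of "\<lambda>h. dist (F (Complex s h)) c < e \<and> Re c + e < Re (F (Complex s h))"]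
        by blast
      have "Re (F (Complex s h) - c) \<le> dist (F (Complex s h)) c"
        unfolding dist_norm by (rule complex_Re_le_cmod)
      then show False using h by simp
    qed
    moreover have "dist (F (Complex s 0)) c \<le> e" if "s < R" for s
    proof (rule tendsto_upperbound[OF _ _ trivial_limit_at_right_real])
      show "((\<lambda>h. dist (F (Complex s h)) c) \<longlongrightarrow> dist (F (Complex s 0)) c) (at_right 0)"
        using calculation[OF that] by (intro tendsto_intros boundary_limit[OF sm])
      show "eventually (\<lambda>h. dist (F (Complex s h)) c \<le> e) (at_right 0)"
        using ev[OF that] by eventually_elim simp
    qed
    ultimately show ?thesis by blast
  qed
  define u where "u s = Re (F (Complex s 0))" for s
  have bdu: "\<exists>R. \<forall>s<R. s \<notin> P \<and> \<bar>u s - Re c\<bar> \<le> e" if e: "e > 0" for e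
  proof -
    have "\<bar>u s - Re c\<bar> \<le> dist (F (Complex s 0)) c" for s
      unfolding dist_norm u_def using abs_Re_le_cmod[of "F (Complex s 0) - c"] by simp
    then show ?thesis using bd[OF e] order_trans by meson
  qed
  from bdu[OF zero_less_one] obtain R where R: "\<And>s. s < R \<Longrightarrow> s \<notin> P" "\<And>s. s < R \<Longrightarrow> \<bar>u s - Re c\<bar> \<le> 1" by blast
  have conv: "(u m - u x) / (m - x) < (u y - u m) / (y - m)" if "x < m" "m < y" "y < R" for x m y
    unfolding u_def using that R(1) by (intro bottom_slopes[OF sm]) auto
  \<comment> \<open>A convex function that fails to increase between m and y has negative slope just
    before m, and so would become large to the left.\<close>
  have mono: "u m < u y" if "m < y" "y < R" for m y
  proof (rule ccontr)
    assume "\<not> u m < u y"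
    then have "(u y - u m) / (y - m) \<le> 0" using that by (simp add: divide_le_0_iff)
    then have "(u m - u (m - 1)) / (m - (m - 1)) < 0" using conv[of "m - 1" m y] that by simp
    then have neg: "u m - u (m - 1) < 0" by simp
    define k where "k = u (m - 1) - u m"
    \<comment> \<open>Over a distance 3 / k with slope below - k the function drops by more than 3,
      while two values within 1 of \<open>Re c\<close> differ by at most 2.\<close>
    define x where "x = m - 1 - 3 / k"
    have k: "k > 0" using neg by (simp add: k_def)
    then have "x < m - 1" by (simp add: x_def)
    from conv[OF this, of m] have "(u (m - 1) - u x) / (3 / k) < - k"
      using that by (simp add: x_def k_def)
    then have "k * (3 + u (m - 1)) < k * u x" using k by (simp add: field_simps)
    then have "u (m - 1) - u x < - 3" using k mult_less_cancel_left_pos[of k] by force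
    then show False using R(2)[of x] R(2)[of "m - 1"] \<open>x < m - 1\<close> that by linarith
  qed
  have "Re c < u s" if "s < R" for s
  proof (rule ccontr)
    assume "\<not> Re c < u s"
    then have "u (s - 1) < Re c" using mono[of "s - 1" s] that by simp
    then have "0 < (Re c - u (s - 1)) / 2" by simp
    from bdu[OF this] obtain R' where R': "\<And>t. t < R' \<Longrightarrow> \<bar>u t - Re c\<bar> \<le> (Re c - u (s - 1)) / 2" by blast
    \<comment> \<open>So far to the left the value is within half the gap of \<open>Re c\<close>,
      yet monotonicity puts it below \<open>u (s - 1)\<close>.\<close>
    define t where "t = min (s - 1) R' - 1"
    have "u t < u (s - 1)" using that by (intro mono) (auto simp: t_def)
    moreover have "\<bar>u t - Re c\<bar> \<le> (Re c - u (s - 1)) / 2" by (intro R') (auto simp: t_def)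
    ultimately show False by (auto simp: abs_if field_simps split: if_splits)
  qed
  moreover have "0 < height F (Re c) s" if "s < R" "Re c < u s" for s
  proof -
    have "((\<lambda>h. Re (F (Complex s h))) \<longlongrightarrow> u s) (at_right 0)"
      unfolding u_def using R(1)[OF that(1)] by (intro tendsto_intros boundary_limit[OF sm])
    then have "eventually (\<lambda>h. Re c < Re (F (Complex s h))) (at_right 0)"
      using that(2) by (rule order_tendstoD)
    moreover have "eventually (\<lambda>h. 0 < h \<and> h < pi) (at_right (0::real))"
      using pi_gt_zero eventually_at_right by blast
    ultimately have "eventually (\<lambda>h. Re c < Re (F (Complex s h)) \<and> 0 < h \<and> h < pi) (at_right 0)"
      by (rule eventually_conj)
    from eventually_happens'[OF trivial_limit_at_right_real this]
    obtain h where "Re c < Re (F (Complex s h))" "0 < h" "h < pi" by blast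
    then show ?thesis using less_height_iff[OF sm, of h "Re c" s] by simp
  qed
  ultimately show ?thesis using that by blast
qed

text \<open>Applied to F and to its reflection, the previous lemma keeps the level curve off both
  lines near the left end. So the curve really runs out to the left, with \<open>Im F\<close>
  strictly increasing from its limit \<open>Im c\<close>; this starting point has no exceptional
  case.\<close>

lemma left_limit_level:
  assumes sm: "strip_map True F P Q" and c: "left_limit F c"
    and n: "n \<in> strip_reg P Q" and eq: "Re (F n) = Re c"
  shows "Im c < Im (F n)"
    and "\<And>y. Im c < y \<Longrightarrow> y < Im (F n) \<Longrightarrow> \<exists>w\<in>strip_reg P Q. Re w < Re n \<and> F w = Complex (Re c) y"
proof -
  obtain R1 where R1: "\<And>s. s < R1 \<Longrightarrow> 0 < height F (Re c) s"
    using left_limit_height_pos[OF sm c] by blast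
  obtain R2 where R2: "\<And>s. s < R2 \<Longrightarrow> 0 < height (refl_strip F) (- Re c) s"
    using left_limit_height_pos[OF strip_map_refl[OF sm] left_limit_refl[OF c]] by auto
  define R where "R = min (Re n) (min R1 R2)"
  define p where "p = level_pt F (Re c)"
  have p: "p s \<in> open_strip" "Re (p s) = s" "Re (F (p s)) = Re c" if "s < R" for s
  proof -
    have h: "0 < height F (Re c) s" "height F (Re c) s < pi"
      using R1[of s] R2[of s] that height_refl[OF sm, of "Re c" s] by (auto simp: R_def)
    then show "p s \<in> open_strip" "Re (p s) = s" "Re (F (p s)) = Re c"
      using Re_at_height[OF sm h] by (auto simp: p_def level_pt_def)
  qed
  have preg: "p s \<in> strip_reg P Q" for s by (simp add: p_def level_pt_reg[OF sm])
  have im: "0 < Im (p s)" "Im (p s) < pi" if "s < R" for s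
    using p(1)[OF that] by (auto simp: open_strip_def)
  have lim: "\<exists>R'. \<forall>s<R'. s < R \<longrightarrow> \<bar>Im (F (p s)) - Im c\<bar> < e" if "e > 0" for e
  proof -
    obtain R' where R': "\<And>w. w \<in> open_strip \<Longrightarrow> Re w < R' \<Longrightarrow> dist (F w) c < e"
      using c \<open>e > 0\<close> unfolding left_limit_def by blast
    have "\<bar>Im (F (p s)) - Im c\<bar> < e" if "s < R'" "s < R" for s
    proof -
      have "dist (F (p s)) c < e" using p[OF that(2)] that(1) by (intro R') auto
      then show ?thesis using abs_Im_le_cmod[of "F (p s) - c"] by (simp add: dist_norm)
    qed
    then show ?thesis by blast
  qed
  have mono: "Im (F (p s)) < Im (F (p t))" if "s < t" "t < R" for s t
    using that p im[of s] by (intro Im_strict_mono[OF sm preg preg]) auto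
  have last: "Im (F (p s)) < Im (F n)" if "s < R" for s
    using that p im[of s] eq by (intro Im_strict_mono[OF sm preg n]) (auto simp: R_def)
  \<comment> \<open>An increasing function stays above its limit at the left end; one further step,
    to n, makes the inequality strict.\<close>
  have "Im c \<le> Im (F (p (R - 1)))"
  proof (rule ccontr)
    assume "\<not> Im c \<le> Im (F (p (R - 1)))"
    then have "0 < Im c - Im (F (p (R - 1)))" by simp
    from lim[OF this] obtain R' where R': "\<And>s. s < R' \<Longrightarrow> s < R \<Longrightarrow> \<bar>Im (F (p s)) - Im c\<bar> < Im c - Im (F (p (R - 1)))"
      by blast
    define s where "s = min R' (R - 1) - 1"
    have "s < R'" "s < R" "s < R - 1" by (auto simp: s_def)
    then show False using R'[of s] mono[of s "R - 1"] by linarith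
  qed
  then show "Im c < Im (F n)" using last[of "R - 1"] by simp
  fix y assume y: "Im c < y" "y < Im (F n)"
  from lim[of "y - Im c"] y obtain R' where R': "\<And>s. s < R' \<Longrightarrow> s < R \<Longrightarrow> \<bar>Im (F (p s)) - Im c\<bar> < y - Im c"
    by auto
  define s where "s = min R' R - 1"
  have s: "s < R'" "s < R" "s < Re n" by (auto simp: s_def R_def)
  have "Im (F (p s)) < y" using R'[OF s(1,2)] by linarith
  then obtain w where "w \<in> strip_reg P Q" "Re (p s) < Re w" "Re w < Re n" "F w = Complex (Re c) y"
    using level_value_attained[OF sm preg n, of s "Re c" y] p[OF s(2)] s(3) eq y(2) by auto
  then show "\<exists>w\<in>strip_reg P Q. Re w < Re n \<and> F w = Complex (Re c) y" by blast
qed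

section \<open>Closure properties\<close>

text \<open>In the variable \<open>exp z\<close> this is the inversion in the unit circle.\<close>

definition inv_strip :: "(complex \<Rightarrow> complex) \<Rightarrow> complex \<Rightarrow> complex" where
  "inv_strip F z = cnj (F (- cnj z))"

lemma refl_inv_strip: "refl_strip (inv_strip F) = inv_strip (refl_strip F)"
proof
  fix z
  have "- cnj (cnj z + \<i> * of_real pi) = cnj (- cnj z) + \<i> * of_real pi"
    by (simp add: complex_eq_iff)
  then show "refl_strip (inv_strip F) z = inv_strip (refl_strip F) z"
    unfolding refl_strip_def inv_strip_def by (simp only: complex_cnj_cnj complex_cnj_minus)
qed

lemma bottom_okD:
  assumes "bottom_ok st F P"
  shows "closed P"
    and "continuous_on {z. 0 \<le> Im z \<and> Im z < pi \<and> (Im z = 0 \<longrightarrow> Re z \<notin> P)} F"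
    and "\<And>x y. x \<le> y \<Longrightarrow> {x..y} \<inter> P = {} \<Longrightarrow> Im (F (of_real x)) = Im (F (of_real y))"
    and "\<And>x m y. x < m \<Longrightarrow> m < y \<Longrightarrow> {x..y} \<inter> P = {} \<Longrightarrow>
      0 \<le> Re (F (of_real y) - F (of_real m)) / (y - m) - Re (F (of_real m) - F (of_real x)) / (m - x)"
    and "\<And>x m y. st \<Longrightarrow> x < m \<Longrightarrow> m < y \<Longrightarrow> {x..y} \<inter> P = {} \<Longrightarrow>
      0 < Re (F (of_real y) - F (of_real m)) / (y - m) - Re (F (of_real m) - F (of_real x)) / (m - x)"
    and "\<And>p. p \<in> P \<Longrightarrow> filterlim (\<lambda>h. Re (F (Complex p h))) at_top (at_right 0)"
  using assms unfolding bottom_ok_def Let_def by auto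

lemma bottom_okI:
  assumes "closed P"
    and "continuous_on {z. 0 \<le> Im z \<and> Im z < pi \<and> (Im z = 0 \<longrightarrow> Re z \<notin> P)} F"
    and "\<And>x y. x \<le> y \<Longrightarrow> {x..y} \<inter> P = {} \<Longrightarrow> Im (F (of_real x)) = Im (F (of_real y))"
    and "\<And>x m y. x < m \<Longrightarrow> m < y \<Longrightarrow> {x..y} \<inter> P = {} \<Longrightarrow>
      0 \<le> Re (F (of_real y) - F (of_real m)) / (y - m) - Re (F (of_real m) - F (of_real x)) / (m - x)
      \<and> (st \<longrightarrow> 0 < Re (F (of_real y) - F (of_real m)) / (y - m) - Re (F (of_real m) - F (of_real x)) / (m - x))"
    and "\<And>p. p \<in> P \<Longrightarrow> filterlim (\<lambda>h. Re (F (Complex p h))) at_top (at_right 0)"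
  shows "bottom_ok st F P"
  unfolding bottom_ok_def Let_def
  using assms by (intro conjI allI impI ballI) blast+

text \<open>Reversing the real line swaps the two slopes and their signs, so their difference is
  unchanged. Conjugation leaves \<open>Re F\<close> alone and only negates the values of
  \<open>Im F\<close>.\<close>

lemma bottom_ok_inv:
  assumes "bottom_ok st F P"
  shows "bottom_ok st (inv_strip F) (uminus ` P)"
proof -
  let ?d = "\<lambda>x m y. Re (inv_strip F (of_real y) - inv_strip F (of_real m)) / (y - m)
       - Re (inv_strip F (of_real m) - inv_strip F (of_real x)) / (m - x)"
  have F: "inv_strip F (of_real x) = cnj (F (of_real (- x)))" for x by (simp add: inv_strip_def)
  have FC: "inv_strip F (Complex x h) = cnj (F (Complex (- x) h))" for x h
  proof -
    have "- cnj (Complex x h) = Complex (- x) h" by (simp add: complex_eq_iff)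
    then show ?thesis by (simp add: inv_strip_def)
  qed
  have um: "x \<in> uminus ` P \<longleftrightarrow> - x \<in> P" for x :: real
    unfolding image_iff by (metis minus_minus)
  have disj: "{- y..- x} \<inter> P = {}" if d: "{x..y} \<inter> uminus ` P = {}" for x y :: real
  proof (rule ccontr)
    assume "{- y..- x} \<inter> P \<noteq> {}"
    then obtain p where "p \<in> P" "- y \<le> p" "p \<le> - x" by auto
    then have "- p \<in> {x..y} \<inter> uminus ` P" by auto
    then show False using d by blast
  qed
  have "closed (uminus ` P)"
    using assms closed_negations unfolding bottom_ok_def by blast
  moreover have "continuous_on {z. 0 \<le> Im z \<and> Im z < pi \<and> (Im z = 0 \<longrightarrow> Re z \<notin> uminus ` P)} (inv_strip F)"
  proof -
    have "continuous_on {z. 0 \<le> Im z \<and> Im z < pi \<and> (Im z = 0 \<longrightarrow> Re z \<notin> P)} F"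
      using assms by (auto simp: bottom_ok_def)
    moreover have "(\<lambda>z. - cnj z) ` {z. 0 \<le> Im z \<and> Im z < pi \<and> (Im z = 0 \<longrightarrow> Re z \<notin> uminus ` P)}
        \<subseteq> {z. 0 \<le> Im z \<and> Im z < pi \<and> (Im z = 0 \<longrightarrow> Re z \<notin> P)}"
      by (auto simp: um)
    ultimately have "continuous_on {z. 0 \<le> Im z \<and> Im z < pi \<and> (Im z = 0 \<longrightarrow> Re z \<notin> uminus ` P)}
        (\<lambda>z. F (- cnj z))"
      by (rule continuous_on_compose2[OF _ continuous_on_minus[OF continuous_on_cnj[OF continuous_on_id]]])
    then show ?thesis unfolding inv_strip_def by (rule continuous_on_cnj)
  qed
  moreover have "Im (inv_strip F (of_real x)) = Im (inv_strip F (of_real y))"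
    if "x \<le> y" "{x..y} \<inter> uminus ` P = {}" for x y
    using bottom_okD(3)[OF assms _ disj[OF that(2)]] that(1) unfolding F by simp
  moreover have "0 \<le> ?d x m y \<and> (st \<longrightarrow> 0 < ?d x m y)"
    if "x < m" "m < y" "{x..y} \<inter> uminus ` P = {}" for x m y
  proof -
    have "Re (F (of_real (- x)) - F (of_real (- m))) / (- x - - m)
       - Re (F (of_real (- m)) - F (of_real (- y))) / (- m - - y) = ?d x m y"
      unfolding F using that by (simp add: divide_simps) (simp add: algebra_simps)
    then show ?thesis
      using bottom_okD(4,5)[OF assms, of "- y" "- m" "- x"] that(1,2) disj[OF that(3)] by auto
  qed
  moreover have "filterlim (\<lambda>h. Re (inv_strip F (Complex p h))) at_top (at_right 0)" if "p \<in> uminus ` P" for p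
    using assms that by (auto simp: FC bottom_ok_def)
  ultimately show ?thesis by (rule bottom_okI)
qed

text \<open>Unlike the reflection, z -> - cnj z maps each boundary line to itself, so P and Q keep
  their roles. Quotients again become minus their conjugates.\<close>

lemma strip_map_inv:
  assumes "strip_map st F P Q"
  shows "strip_map st (inv_strip F) (uminus ` P) (uminus ` Q)"
proof -
  have "0 \<le> Im ((inv_strip F n - inv_strip F z) / (n - z)) \<and>
      (st \<longrightarrow> 0 < Im ((inv_strip F n - inv_strip F z) / (n - z)))"
    if "z \<in> open_strip" "n \<in> open_strip" "z \<noteq> n" for z n
  proof -
    let ?z = "- cnj z" and ?n = "- cnj n"
    have "?z \<in> open_strip" "?n \<in> open_strip" "?z \<noteq> ?n"
      using that by (auto simp: open_strip_def)
    then have *: "0 \<le> Im ((F ?n - F ?z) / (?n - ?z)) \<and> (st \<longrightarrow> 0 < Im ((F ?n - F ?z) / (?n - ?z)))"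
      using assms unfolding strip_map_def by blast
    have "cnj (?n - ?z) = - (n - z)" by simp
    moreover have "inv_strip F n - inv_strip F z = cnj (F ?n - F ?z)"
      by (simp add: inv_strip_def)
    ultimately have "(inv_strip F n - inv_strip F z) / (n - z) = - cnj ((F ?n - F ?z) / (?n - ?z))"
      by (metis complex_cnj_divide minus_divide_right minus_minus)
    then have "Im ((inv_strip F n - inv_strip F z) / (n - z)) = Im ((F ?n - F ?z) / (?n - ?z))"
      by (simp only: uminus_complex.sel cnj.sel minus_minus)
    then show ?thesis using * by simp
  qed
  then show ?thesis using assms unfolding strip_map_def refl_inv_strip by (metis bottom_ok_inv)
qed

lemma bottom_ok_scale:
  assumes "bottom_ok st F P" and k: "k > 0"
  shows "bottom_ok st (\<lambda>z. of_real k * F z) P"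
proof -
  have s: "Re (of_real k * a - of_real k * b) / c - Re (of_real k * b - of_real k * d) / e
      = k * (Re (a - b) / c - Re (b - d) / e)" for a b d c e
    by (simp add: algebra_simps diff_divide_distrib)
  have t: "filterlim (\<lambda>h. Re (of_real k * F (Complex p h))) at_top (at_right 0)" if "p \<in> P" for p
  proof -
    have "filterlim (\<lambda>h. k * Re (F (Complex p h))) at_top (at_right 0)"
      using assms that by (intro filterlim_tendsto_pos_mult_at_top[OF tendsto_const]) (auto simp: bottom_ok_def)
    then show ?thesis by simp
  qed
  have "closed P" "continuous_on {z. 0 \<le> Im z \<and> Im z < pi \<and> (Im z = 0 \<longrightarrow> Re z \<notin> P)} (\<lambda>z. of_real k * F z)"
    "\<forall>x y. x \<le> y \<and> {x..y} \<inter> P = {} \<longrightarrow> Im (of_real k * F (of_real x)) = Im (of_real k * F (of_real y))"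
    using assms unfolding bottom_ok_def by (auto intro!: continuous_intros)
  moreover have "let d = Re (of_real k * F (of_real y) - of_real k * F (of_real m)) / (y - m)
       - Re (of_real k * F (of_real m) - of_real k * F (of_real x)) / (m - x) in 0 \<le> d \<and> (st \<longrightarrow> 0 < d)"
    if "x < m \<and> m < y \<and> {x..y} \<inter> P = {}" for x m y
    using assms(1) that k unfolding bottom_ok_def s by (auto simp: Let_def zero_le_mult_iff zero_less_mult_iff)
  ultimately show ?thesis using t unfolding bottom_ok_def by blast
qed

lemma strip_map_scale:
  assumes "strip_map st F P Q" and k: "k > 0"
  shows "strip_map st (\<lambda>z. of_real k * F z) P Q"
proof -
  have r: "refl_strip (\<lambda>z. of_real k * F z) = (\<lambda>z. of_real k * refl_strip F z)"
    by (simp add: refl_strip_def fun_eq_iff)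
  have q: "Im ((of_real k * a - of_real k * b) / c) = k * Im ((a - b) / c)" for a b c
  proof -
    have "(of_real k * a - of_real k * b) / c = of_real k * ((a - b) / c)" by (simp add: algebra_simps)
    then show ?thesis by (metis Im_complex_of_real Im_divide_of_real Re_complex_of_real add_0_right mult_zero_left times_complex.sel(2))
  qed
  show ?thesis using assms bottom_ok_scale[of st _ _ k] unfolding strip_map_def r q
    by (auto simp: zero_le_mult_iff zero_less_mult_iff)
qed

lemma bottom_ok_affine: "bottom_ok False (\<lambda>z. of_real B * z + C) {}"
proof -
  have "0 = Re (of_real B * of_real y + C - (of_real B * of_real m + C)) / (y - m)
      - Re (of_real B * of_real m + C - (of_real B * of_real x + C)) / (m - x)"
    if "x < m" "m < y" for x m y :: real
    using that by (simp add: divide_simps) (simp add: algebra_simps)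
  then show ?thesis unfolding bottom_ok_def
    by (auto intro!: continuous_intros simp: Let_def)
qed

text \<open>The quotient is the real number B, whose sign does not matter; for the same reason this
  part never contributes strictness.\<close>

lemma strip_map_affine: "strip_map False (\<lambda>z. of_real B * z + C) {} {}"
proof -
  have r: "refl_strip (\<lambda>z. of_real B * z + C) = (\<lambda>z. of_real (- B) * z + (\<i> * of_real (B * pi) - cnj C))"
    by (simp add: refl_strip_def fun_eq_iff algebra_simps)
  have q: "Im ((of_real B * n + C - (of_real B * z + C)) / (n - z)) = 0" if "z \<noteq> n" for z n
  proof -
    have "(of_real B * n + C - (of_real B * z + C)) / (n - z) = of_real B"
      using that by (simp add: divide_simps) (simp add: algebra_simps)
    then show ?thesis by (metis Im_complex_of_real)
  qed
  show ?thesis unfolding strip_map_def r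
    by (intro conjI bottom_ok_affine ballI impI) (use q in simp_all)
qed

text \<open>The bound covers all imaginary parts, so it survives reflection. It is asked only
  eventually, because the estimate of a logarithm needs a small argument, which finitely many
  factors may violate.\<close>

definition locally_summable :: "(nat \<Rightarrow> complex \<Rightarrow> complex) \<Rightarrow> bool" where
  "locally_summable F \<longleftrightarrow> (\<forall>R. \<exists>M. summable M \<and>
     eventually (\<lambda>\<nu>. \<forall>z. \<bar>Re z\<bar> \<le> R \<longrightarrow> norm (F \<nu> z) \<le> M \<nu>) sequentially)"

lemma locally_summableD:
  assumes "locally_summable F" shows "summable (\<lambda>\<nu>. F \<nu> z)"
proof -
  obtain M where "summable M" and ev: "eventually (\<lambda>\<nu>. \<forall>w. \<bar>Re w\<bar> \<le> \<bar>Re z\<bar> \<longrightarrow> norm (F \<nu> w) \<le> M \<nu>) sequentially"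
    using assms unfolding locally_summable_def by blast
  from ev have "eventually (\<lambda>\<nu>. norm (F \<nu> z) \<le> M \<nu>) sequentially" by eventually_elim simp
  then show ?thesis using \<open>summable M\<close> by (rule summable_comparison_test_ev)
qed

text \<open>Local finiteness makes the union of the singular sets closed, and the M-test gives
  continuity. At a singularity the other terms might cancel the blow-up; \<open>mono\<close>
  prevents this by bounding each of them below by its value at a fixed height.\<close>

lemma bottom_ok_suminf:
  assumes ok: "\<And>\<nu>. bottom_ok (st \<nu>) (F \<nu>) (P \<nu>)" and ls: "locally_summable F"
    and fin: "\<And>R. eventually (\<lambda>\<nu>. P \<nu> \<inter> {- R..R} = {}) sequentially"
    and mono: "\<And>\<nu> p h k. 0 < h \<Longrightarrow> h \<le> k \<Longrightarrow> k < pi \<Longrightarrow> Re (F \<nu> (Complex p k)) \<le> Re (F \<nu> (Complex p h))"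
  shows "bottom_ok (\<exists>\<nu>. st \<nu>) (\<lambda>z. \<Sum>\<nu>. F \<nu> z) (\<Union>\<nu>. P \<nu>)"
proof -
  note sm = locally_summableD[OF ls]
  let ?P = "\<Union>\<nu>. P \<nu>" and ?F = "\<lambda>z. \<Sum>\<nu>. F \<nu> z"
  let ?d = "\<lambda>x m y. Re (?F (of_real y) - ?F (of_real m)) / (y - m)
       - Re (?F (of_real m) - ?F (of_real x)) / (m - x)"
  let ?D = "{z. 0 \<le> Im z \<and> Im z < pi \<and> (Im z = 0 \<longrightarrow> Re z \<notin> ?P)}"
  have "closed ?P"
  proof -
    have "open (- ?P)" unfolding open_contains_ball
    proof
      fix x assume x: "x \<in> - ?P"
      from fin[of "\<bar>x\<bar> + 1"] obtain N where N: "\<And>\<nu>. \<nu> \<ge> N \<Longrightarrow> P \<nu> \<inter> {- (\<bar>x\<bar> + 1)..\<bar>x\<bar> + 1} = {}"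
        by (auto simp: eventually_sequentially)
      \<comment> \<open>In a bounded window only the first N sets matter, so finitely many open
        complements suffice.\<close>
      let ?V = "(\<Inter>\<nu><N. - P \<nu>) \<inter> {- (\<bar>x\<bar> + 1)<..<\<bar>x\<bar> + 1}"
      have "open ?V" using ok unfolding bottom_ok_def by (intro open_Int open_INT) auto
      moreover have "x \<in> ?V" using x by auto
      ultimately obtain e where e: "e > 0" "ball x e \<subseteq> ?V" by (rule openE)
      have "?V \<subseteq> - ?P"
      proof
        fix y assume y: "y \<in> ?V"
        have "y \<notin> P \<nu>" for \<nu>
        proof (cases "\<nu> < N")
          case False
          moreover have "y \<in> {- (\<bar>x\<bar> + 1)..\<bar>x\<bar> + 1}" using y by simp
          ultimately show ?thesis using N[of \<nu>] not_le by blast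
        qed (use y in auto)
        then show "y \<in> - ?P" by blast
      qed
      with e show "\<exists>e>0. ball x e \<subseteq> - ?P" by blast
    qed
    then show ?thesis by (simp add: closed_def)
  qed
  moreover have "continuous_on ?D ?F"
    unfolding continuous_on_eq_continuous_within
  proof
    fix z assume z: "z \<in> ?D"
    define R where "R = \<bar>Re z\<bar> + 1"
    let ?U = "{w. \<bar>Re w\<bar> < R}"
    have oU: "open ?U" by (intro open_Collect_less continuous_intros)
    obtain M where M: "summable M" and ev: "eventually (\<lambda>\<nu>. \<forall>w. \<bar>Re w\<bar> \<le> R \<longrightarrow> norm (F \<nu> w) \<le> M \<nu>) sequentially"
      using ls unfolding locally_summable_def by blast
    have "eventually (\<lambda>\<nu>. \<forall>w\<in>?D \<inter> ?U. norm (F \<nu> w) \<le> M \<nu>) sequentially"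
      using ev by eventually_elim auto
    then have u: "uniform_limit (?D \<inter> ?U) (\<lambda>n x. \<Sum>i<n. F i x) ?F sequentially"
      using M by (rule Weierstrass_m_test_ev)
    have "continuous_on (?D \<inter> ?U) (F i)" for i
      using ok[of i] unfolding bottom_ok_def by (rule continuous_on_subset[OF conjunct1[OF conjunct2]]) auto
    then have "continuous_on (?D \<inter> ?U) ?F"
      by (intro uniform_limit_theorem[OF _ u] always_eventually allI continuous_on_sum) auto
    then have "continuous (at z within ?D \<inter> ?U) ?F"
      using z by (auto simp: continuous_on_eq_continuous_within R_def)
    moreover have "at z within ?D \<inter> ?U = at z within ?D"
      by (rule at_within_nhd[OF _ oU]) (auto simp: R_def)
    ultimately show "continuous (at z within ?D) ?F" by simp
  qed
  moreover have "Im (?F (of_real x)) = Im (?F (of_real y))" if "x \<le> y" "{x..y} \<inter> ?P = {}" for x y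
  proof -
    have "{x..y} \<inter> P \<nu> = {}" for \<nu> using that by blast
    then have "Im (F \<nu> (of_real x)) = Im (F \<nu> (of_real y))" for \<nu>
      using bottom_okD(3)[OF ok that(1)] by simp
    then show ?thesis by (simp only: Im_suminf[OF sm])
  qed
  moreover have "0 \<le> ?d x m y \<and> ((\<exists>\<nu>. st \<nu>) \<longrightarrow> 0 < ?d x m y)"
    if xy: "x < m" "m < y" "{x..y} \<inter> ?P = {}" for x m y
  proof -
    define d where "d \<nu> = Re (F \<nu> (of_real y) - F \<nu> (of_real m)) / (y - m)
       - Re (F \<nu> (of_real m) - F \<nu> (of_real x)) / (m - x)" for \<nu>
    have "{x..y} \<inter> P \<nu> = {}" for \<nu> using xy(3) by blast
    then have d: "0 \<le> d \<nu> \<and> (st \<nu> \<longrightarrow> 0 < d \<nu>)" for \<nu>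
      using bottom_okD(4)[OF ok xy(1,2)] bottom_okD(5)[OF ok _ xy(1,2)] by (simp add: d_def)
    have s: "d sums ?d x m y"
      unfolding d_def by (intro sums_diff sums_divide sums_Re summable_sums sm)
    have "0 \<le> suminf d" using d by (intro suminf_nonneg sums_summable[OF s]) simp
    moreover have "0 < suminf d" if "\<exists>\<nu>. st \<nu>"
      using that d suminf_pos2[OF sums_summable[OF s]] by blast
    ultimately show ?thesis using sums_unique[OF s] by simp
  qed
  moreover have "filterlim (\<lambda>h. Re (?F (Complex p h))) at_top (at_right 0)" if p: "p \<in> ?P" for p
  proof -
    obtain \<mu> where "p \<in> P \<mu>" using p by blast
    then have top: "filterlim (\<lambda>h. Re (F \<mu> (Complex p h))) at_top (at_right 0)"
      by (rule bottom_okD(6)[OF ok])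
    \<comment> \<open>The reference height 1 lies inside the strip. No term decreases on the way
      down from it, so the sum increases by at least as much as the singular term.\<close>
    let ?c = "Re (?F (Complex p 1)) - Re (F \<mu> (Complex p 1))"
    have le: "?c + Re (F \<mu> (Complex p h)) \<le> Re (?F (Complex p h))" if h: "0 < h" "h < 1" for h
    proof -
      define d where "d \<nu> = Re (F \<nu> (Complex p h) - F \<nu> (Complex p 1))" for \<nu>
      have d: "0 \<le> d \<nu>" for \<nu> using mono[of h 1 \<nu> p] h pi_gt3 by (simp add: d_def)
      have s: "d sums Re (?F (Complex p h) - ?F (Complex p 1))"
        unfolding d_def by (intro sums_diff sums_Re summable_sums sm)
      have "sum d {\<mu>} \<le> suminf d" using d by (intro sum_le_suminf sums_summable[OF s]) auto
      then have "d \<mu> \<le> Re (?F (Complex p h) - ?F (Complex p 1))" using sums_unique[OF s] by simp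
      then show ?thesis by (simp add: d_def)
    qed
    have "filterlim (\<lambda>h. ?c + Re (F \<mu> (Complex p h))) at_top (at_right 0)"
      by (intro filterlim_tendsto_add_at_top[OF tendsto_const] top)
    moreover have "eventually (\<lambda>h. ?c + Re (F \<mu> (Complex p h)) \<le> Re (?F (Complex p h))) (at_right 0)"
      unfolding eventually_at_right[OF zero_less_one] using le by (intro exI[of _ 1]) auto
    ultimately show ?thesis by (rule filterlim_at_top_mono)
  qed
  ultimately show ?thesis by (rule bottom_okI)
qed

lemma Re_antimono:
  assumes sm: "strip_map st F P Q" and "0 < h" "h \<le> k" "k < pi"
  shows "Re (F (Complex p k)) \<le> Re (F (Complex p h))"
proof (cases "h = k")
  case False
  then have "0 \<le> Im ((F (Complex p k) - F (Complex p h)) / (Complex p k - Complex p h))"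
    using assms by (intro quotient_Im_nonneg[OF sm] Complex_reg) auto
  moreover have "Complex p k - Complex p h = \<i> * of_real (k - h)" by (simp add: complex_eq_iff)
  ultimately show ?thesis using False \<open>h \<le> k\<close>
    by (simp add: Im_divide divide_le_0_iff zero_le_divide_iff power2_eq_square mult_le_0_iff)
qed simp

lemma strip_map_suminf:
  assumes ok: "\<And>\<nu>. strip_map (st \<nu>) (F \<nu>) (P \<nu>) (Q \<nu>)" and ls: "locally_summable F"
    and fin: "\<And>R. eventually (\<lambda>\<nu>. (P \<nu> \<union> Q \<nu>) \<inter> {- R..R} = {}) sequentially"
  shows "strip_map (\<exists>\<nu>. st \<nu>) (\<lambda>z. \<Sum>\<nu>. F \<nu> z) (\<Union>\<nu>. P \<nu>) (\<Union>\<nu>. Q \<nu>)"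
proof -
  note sm = locally_summableD[OF ls]
  let ?F = "\<lambda>z. \<Sum>\<nu>. F \<nu> z"
  have P: "eventually (\<lambda>\<nu>. P \<nu> \<inter> {- R..R} = {}) sequentially"
    and Q: "eventually (\<lambda>\<nu>. Q \<nu> \<inter> {- R..R} = {}) sequentially" for R
    using fin[of R] by (auto elim: eventually_mono)
  have ls': "locally_summable (\<lambda>\<nu>. refl_strip (F \<nu>))"
    unfolding locally_summable_def
  proof
    fix R
    obtain M where M: "summable M" and ev: "eventually (\<lambda>\<nu>. \<forall>w. \<bar>Re w\<bar> \<le> R \<longrightarrow> norm (F \<nu> w) \<le> M \<nu>) sequentially"
      using ls unfolding locally_summable_def by blast
    from ev have "eventually (\<lambda>\<nu>. \<forall>w. \<bar>Re w\<bar> \<le> R \<longrightarrow> norm (refl_strip (F \<nu>) w) \<le> M \<nu>) sequentially"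
      by eventually_elim (simp add: refl_strip_def)
    with M show "\<exists>M. summable M \<and> eventually (\<lambda>\<nu>. \<forall>w. \<bar>Re w\<bar> \<le> R \<longrightarrow> norm (refl_strip (F \<nu>) w) \<le> M \<nu>) sequentially"
      by blast
  qed
  have r: "refl_strip ?F = (\<lambda>z. \<Sum>\<nu>. refl_strip (F \<nu>) z)"
  proof
    fix z
    have "(\<lambda>\<nu>. refl_strip (F \<nu>) z) sums refl_strip ?F z"
      unfolding refl_strip_def by (intro sums_minus summable_sums sm iffD2[OF sums_cnj])
    then show "refl_strip ?F z = (\<Sum>\<nu>. refl_strip (F \<nu>) z)" by (rule sums_unique)
  qed
  have "bottom_ok (\<exists>\<nu>. st \<nu>) ?F (\<Union>\<nu>. P \<nu>)"
    using ok by (intro bottom_ok_suminf ls P Re_antimono[OF ok]) (auto simp: strip_map_def)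
  moreover have "bottom_ok (\<exists>\<nu>. st \<nu>) (refl_strip ?F) (\<Union>\<nu>. Q \<nu>)"
    unfolding r
    using ok by (intro bottom_ok_suminf ls' Q Re_antimono[OF strip_map_refl[OF ok]]) (auto simp: strip_map_def)
  moreover have "0 \<le> Im ((?F n - ?F z) / (n - z)) \<and> ((\<exists>\<nu>. st \<nu>) \<longrightarrow> 0 < Im ((?F n - ?F z) / (n - z)))"
    if "z \<in> open_strip" "n \<in> open_strip" "z \<noteq> n" for z n
  proof -
    define d where "d \<nu> = Im ((F \<nu> n - F \<nu> z) / (n - z))" for \<nu>
    have d: "0 \<le> d \<nu> \<and> (st \<nu> \<longrightarrow> 0 < d \<nu>)" for \<nu>
      using ok[of \<nu>] that unfolding strip_map_def d_def by blast
    have s: "d sums Im ((?F n - ?F z) / (n - z))"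
      unfolding d_def by (intro sums_diff sums_divide sums_Im summable_sums sm)
    have "0 \<le> suminf d" using d by (intro suminf_nonneg sums_summable[OF s]) simp
    moreover have "0 < suminf d" if "\<exists>\<nu>. st \<nu>"
      using that d suminf_pos2[OF sums_summable[OF s]] by blast
    ultimately show ?thesis using sums_unique[OF s] by simp
  qed
  ultimately show ?thesis unfolding strip_map_def by blast
qed

text \<open>Treated as a series with two prescribed terms; the tail consists of the zero map, which
  is affine.\<close>

lemma strip_map_add:
  assumes F: "strip_map s F P Q" and G: "strip_map t G P' Q'"
  shows "strip_map (s \<or> t) (\<lambda>z. F z + G z) (P \<union> P') (Q \<union> Q')"
proof -
  define H where "H \<nu> = (if \<nu> = 0 then F else if \<nu> = 1 then G else (\<lambda>z. of_real 0 * z + 0))" for \<nu> :: nat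
  define st where "st \<nu> = (if \<nu> = 0 then s else if \<nu> = 1 then t else False)" for \<nu> :: nat
  define p where "p \<nu> = (if \<nu> = 0 then P else if \<nu> = 1 then P' else {})" for \<nu> :: nat
  define q where "q \<nu> = (if \<nu> = 0 then Q else if \<nu> = 1 then Q' else {})" for \<nu> :: nat
  have ev: "eventually (\<lambda>\<nu>::nat. \<nu> > 1) sequentially" by (rule eventually_gt_at_top)
  have "strip_map (st \<nu>) (H \<nu>) (p \<nu>) (q \<nu>)" for \<nu>
    using F G strip_map_affine[of 0 0] by (simp add: H_def st_def p_def q_def)
  moreover have "locally_summable H"
    unfolding locally_summable_def
    by (intro allI exI[of _ "\<lambda>_. 0"] conjI eventually_mono[OF ev]) (auto simp: H_def)
  moreover have "eventually (\<lambda>\<nu>. (p \<nu> \<union> q \<nu>) \<inter> {- R..R} = {}) sequentially" for R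
    by (rule eventually_mono[OF ev]) (auto simp: p_def q_def)
  ultimately have "strip_map (\<exists>\<nu>. st \<nu>) (\<lambda>z. \<Sum>\<nu>. H \<nu> z) (\<Union>\<nu>. p \<nu>) (\<Union>\<nu>. q \<nu>)"
    by (rule strip_map_suminf)
  moreover have "(\<exists>\<nu>. st \<nu>) = (s \<or> t)" by (auto simp: st_def split: if_splits)
  moreover have "(\<Sum>\<nu>. H \<nu> z) = F z + G z" for z
  proof -
    have "(\<Sum>\<nu>. H \<nu> z) = (\<Sum>\<nu>\<in>{0,1}. H \<nu> z)" by (rule suminf_finite) (auto simp: H_def)
    then show ?thesis by (simp add: H_def)
  qed
  moreover have "(\<Union>\<nu>. p \<nu>) = P \<union> P'" "(\<Union>\<nu>. q \<nu>) = Q \<union> Q'"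
    by (auto simp: p_def q_def split: if_splits)
  ultimately show ?thesis by simp
qed

section \<open>The factors of \<open>W\<close>\<close>

text \<open>The quotient is a mean of f' over the segment from z to n. Dividing by n - z cancels the
  inner derivative of the parametrised segment, so the real mean value theorem for the imaginary
  part yields a value of \<open>Im (f' w)\<close>.\<close>

lemma Im_quotient_pos_of_deriv:
  assumes "convex S" and z: "z \<in> S" and n: "n \<in> S" and "z \<noteq> n"
    and d: "\<And>w. w \<in> S \<Longrightarrow> (f has_field_derivative f' w) (at w)"
    and pos: "\<And>w. w \<in> S \<Longrightarrow> 0 < Im (f' w)"
  shows "0 < Im ((f n - f z) / (n - z))"
proof -
  define g where "g t = Im (f (z + of_real t * (n - z)) / (n - z))" for t
  let ?p = "\<lambda>t. z + of_real t * (n - z)"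
  have p: "?p t \<in> S" if "0 \<le> t" "t \<le> 1" for t
    using convexD_alt[OF \<open>convex S\<close> z n that] by (simp add: scaleR_conv_of_real algebra_simps)
  have g': "(g has_real_derivative Im (f' (?p t))) (at t)" if "0 \<le> t" "t \<le> 1" for t
  proof -
    have "(?p has_vector_derivative (n - z)) (at t)"
      by (auto intro!: derivative_eq_intros simp: has_vector_derivative_def scaleR_conv_of_real)
    from field_vector_diff_chain_at[OF this d[OF p[OF that]]]
    have "((\<lambda>t. f (?p t)) has_vector_derivative (n - z) * f' (?p t)) (at t)"
      by (simp add: o_def)
    then have "((\<lambda>t. f (?p t) / (n - z)) has_vector_derivative (n - z) * f' (?p t) / (n - z)) (at t)"
      by (rule bounded_linear.has_vector_derivative[OF bounded_linear_divide])
    then have "((\<lambda>t. Im (f (?p t) / (n - z))) has_vector_derivative Im ((n - z) * f' (?p t) / (n - z))) (at t)"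
      by (rule bounded_linear.has_vector_derivative[OF bounded_linear_Im])
    then show ?thesis
      using \<open>z \<noteq> n\<close> by (simp add: g_def [abs_def] has_real_derivative_iff_has_vector_derivative)
  qed
  obtain t where "0 < t" "t < 1" "g 1 - g 0 = (1 - 0) * Im (f' (?p t))"
    using MVT2[of 0 1 g "\<lambda>t. Im (f' (?p t))"] g' by auto
  then have "0 < g 1 - g 0" using pos[OF p[of t]] by simp
  then show ?thesis by (simp add: g_def diff_divide_distrib)
qed

lemma convex_open_strip: "convex open_strip"
  unfolding open_strip_def Collect_conj_eq
  by (intro convex_Int convex_halfspace_Im_gt convex_halfspace_Im_lt)

lemma strict_slopes:
  fixes u :: "real \<Rightarrow> real"
  assumes "x < m" "m < y"
    and d: "\<And>t. x \<le> t \<Longrightarrow> t \<le> y \<Longrightarrow> (u has_real_derivative u' t) (at t)"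
    and inc: "\<And>s t. x \<le> s \<Longrightarrow> s < t \<Longrightarrow> t \<le> y \<Longrightarrow> u' s < u' t"
  shows "0 < (u y - u m) / (y - m) - (u m - u x) / (m - x)"
proof -
  obtain s where s: "x < s" "s < m" "u m - u x = (m - x) * u' s"
    using MVT2[of x m u u'] d assms(1,2) by auto
  obtain t where t: "m < t" "t < y" "u y - u m = (y - m) * u' t"
    using MVT2[of m y u u'] d assms(1,2) by auto
  have "u' s < u' t" using s t by (intro inc) auto
  then show ?thesis using s t assms(1,2) by simp
qed

section \<open>The exponential and a single logarithmic factor\<close>

lemma Im_exp_pos: "z \<in> open_strip \<Longrightarrow> 0 < Im (exp z)"
  by (simp add: open_strip_def Im_exp sin_gt_zero)

lemma strip_map_exp: "strip_map True exp {} {}"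
proof -
  have "bottom_ok True exp {}"
  proof (rule bottom_okI)
    fix x m y :: real assume "x < m" "m < y"
    then have "0 < (exp y - exp m) / (y - m) - (exp m - exp x) / (m - x)"
      by (rule strict_slopes[where u'=exp]) (auto intro!: derivative_eq_intros)
    then show "0 \<le> Re (exp (of_real y) - exp (of_real m)) / (y - m) - Re (exp (of_real m) - exp (of_real x)) / (m - x)
      \<and> (True \<longrightarrow> 0 < Re (exp (of_real y) - exp (of_real m)) / (y - m) - Re (exp (of_real m) - exp (of_real x)) / (m - x))"
      by (simp add: exp_of_real)
  qed (auto intro!: continuous_intros simp: exp_of_real)
  moreover have "refl_strip exp = (exp :: complex \<Rightarrow> complex)"
    by (simp add: refl_strip_def fun_eq_iff exp_add exp_cnj)
  ultimately show ?thesis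
    unfolding strip_map_def
    using Im_quotient_pos_of_deriv[OF convex_open_strip _ _ _ DERIV_exp Im_exp_pos] less_imp_le by metis
qed

text \<open>Seen from above, the principal logarithm does not jump at its cut: dividing by i turns
  the closed upper half-plane into the closed right one, away from the cut, and adds only the
  constant i pi / 2.\<close>

lemma continuous_on_Ln_upper: "continuous_on {w. 0 \<le> Im w \<and> w \<noteq> 0} Ln"
proof -
  have eq: "Ln w = Ln (w / \<i>) + \<i> * of_real (pi / 2)" if "0 \<le> Im w" "w \<noteq> 0" for w
  proof -
    have "0 \<le> Re (w / \<i>)" "w / \<i> \<noteq> 0" using that by auto
    then have "\<bar>Im (Ln (w / \<i>))\<bar> \<le> pi / 2" using Re_Ln_pos_le by blast
    moreover have "Im (Ln (w / \<i>) + \<i> * of_real (pi / 2)) = Im (Ln (w / \<i>)) + pi / 2" by simp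
    ultimately have "- pi < Im (Ln (w / \<i>) + \<i> * of_real (pi / 2))"
      "Im (Ln (w / \<i>) + \<i> * of_real (pi / 2)) \<le> pi"
      using pi_gt_zero by linarith+
    then have "Ln (exp (Ln (w / \<i>) + \<i> * of_real (pi / 2))) = Ln (w / \<i>) + \<i> * of_real (pi / 2)"
      by (rule Ln_exp)
    moreover have "exp (Ln (w / \<i>) + \<i> * of_real (pi / 2)) = w"
      using that exp_Euler[of "of_real (pi / 2)"] by (simp add: exp_add cos_of_real sin_of_real mult.commute mult.left_commute)
    ultimately show ?thesis by simp
  qed
  have "w / \<i> \<notin> \<real>\<^sub>\<le>\<^sub>0" if "0 \<le> Im w" "w \<noteq> 0" for w
    using that by (auto simp: complex_nonpos_Reals_iff complex_eq_iff)
  then have "continuous_on {w. 0 \<le> Im w \<and> w \<noteq> 0} (\<lambda>w. Ln (w / \<i>) + \<i> * of_real (pi / 2))"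
    by (intro continuous_intros) auto
  then show ?thesis by (rule continuous_on_eq) (use eq in auto)
qed

text \<open>One model for all four products: on the open strip, with Z = exp z, it is the logarithm
  of 1 + Z / a, its reflection is that of 1 / (1 - Z / a), and \<open>inv_strip\<close> replaces Z
  by 1 / Z in either.\<close>

definition Ln_term :: "real \<Rightarrow> complex \<Rightarrow> complex" where
  "Ln_term a z = Ln (1 + exp z / of_real a)"

text \<open>For w = exp z the imaginary part of w / (a + w) is a Im w / |a + w|^2.\<close>

lemma Ln_term_deriv:
  assumes a: "a > 0" and z: "z \<in> open_strip"
  shows "(Ln_term a has_field_derivative exp z / (of_real a + exp z)) (at z)"
    and "0 < Im (exp z / (of_real a + exp z))"
proof -
  have im: "0 < Im (exp z)" using Im_exp_pos[OF z] .
  then have im': "0 < Im (1 + exp z / of_real a)" using a by simp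
  then have "1 + exp z / of_real a \<notin> \<real>\<^sub>\<le>\<^sub>0" by (auto simp: complex_nonpos_Reals_iff)
  then have "(Ln_term a has_field_derivative exp z / of_real a / (1 + exp z / of_real a)) (at z)"
    unfolding Ln_term_def using a by (auto intro!: derivative_eq_intros simp: divide_inverse)
  moreover have "exp z / of_real a / (1 + exp z / of_real a) = exp z / (of_real a + exp z)"
    using a by (simp add: divide_simps add.commute)
  ultimately show "(Ln_term a has_field_derivative exp z / (of_real a + exp z)) (at z)" by simp
  have "of_real a + exp z \<noteq> 0" using im by (auto simp: complex_eq_iff)
  then have "0 < (Re (of_real a + exp z))\<^sup>2 + (Im (of_real a + exp z))\<^sup>2"
    by (metis complex_neq_0)
  then show "0 < Im (exp z / (of_real a + exp z))"
    unfolding Im_divide using im a by (intro divide_pos_pos) (auto simp: algebra_simps)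
qed

lemma bottom_ok_Ln_term:
  assumes a: "a > 0" shows "bottom_ok True (Ln_term a) {}"
proof (rule bottom_okI)
  have "1 + exp z / of_real a \<notin> \<real>\<^sub>\<le>\<^sub>0" if "0 \<le> Im z" "Im z < pi" for z
  proof (cases "Im z = 0")
    case True
    then have "0 < Re (exp z)" by (simp add: Re_exp)
    then have "0 < Re (1 + exp z / of_real a)" using a by (simp add: add_pos_pos)
    then show ?thesis by (auto simp: complex_nonpos_Reals_iff)
  next
    case False
    then have "0 < Im (exp z)" using that by (intro Im_exp_pos) (auto simp: open_strip_def)
    then show ?thesis using a by (auto simp: complex_nonpos_Reals_iff)
  qed
  then show "continuous_on {z. 0 \<le> Im z \<and> Im z < pi \<and> (Im z = 0 \<longrightarrow> Re z \<notin> {})} (Ln_term a)"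
    unfolding Ln_term_def using a by (intro continuous_intros) auto
  have r: "Ln_term a (of_real x) = of_real (ln (1 + exp x / a))" for x
  proof -
    have "0 < 1 + exp x / a" using a by (simp add: add_pos_pos)
    then show ?thesis unfolding Ln_term_def by (simp add: exp_of_real flip: Ln_of_real)
  qed
  show "Im (Ln_term a (of_real x)) = Im (Ln_term a (of_real y))" for x y by (simp add: r)
  fix x m y :: real assume xy: "x < m" "m < y"
  have "0 < (ln (1 + exp y / a) - ln (1 + exp m / a)) / (y - m) - (ln (1 + exp m / a) - ln (1 + exp x / a)) / (m - x)"
  proof (rule strict_slopes[OF xy, where u' = "\<lambda>t. exp t / (a + exp t)"])
    fix t :: real
    have "0 < 1 + exp t / a" using a by (simp add: add_pos_pos)
    then have "((\<lambda>x. ln (1 + exp x / a)) has_real_derivative (exp t / a) / (1 + exp t / a)) (at t)"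
      using a by (auto intro!: derivative_eq_intros)
    moreover have "(exp t / a) / (1 + exp t / a) = exp t / (a + exp t)"
      using a by (simp add: divide_simps add.commute)
    ultimately show "((\<lambda>x. ln (1 + exp x / a)) has_real_derivative exp t / (a + exp t)) (at t)" by simp
  next
    fix s t :: real assume "s < t"
    moreover have "0 < a + exp s" "0 < a + exp t" using a by (simp_all add: add_pos_pos)
    ultimately show "exp s / (a + exp s) < exp t / (a + exp t)"
      using a by (simp add: divide_simps algebra_simps)
  qed
  then show "0 \<le> Re (Ln_term a (of_real y) - Ln_term a (of_real m)) / (y - m)
      - Re (Ln_term a (of_real m) - Ln_term a (of_real x)) / (m - x) \<and>
      (True \<longrightarrow> 0 < Re (Ln_term a (of_real y) - Ln_term a (of_real m)) / (y - m)
      - Re (Ln_term a (of_real m) - Ln_term a (of_real x)) / (m - x))"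
    by (simp add: r)
qed auto

lemma refl_Ln_term: "refl_strip (Ln_term a) z = - cnj (Ln (1 - cnj (exp z) / of_real a))"
  by (simp add: refl_strip_def Ln_term_def exp_add exp_cnj)

lemma refl_Ln_term_of_real:
  "refl_strip (Ln_term a) (of_real x) = - cnj (Ln (of_real (1 - exp x / a)))"
  unfolding refl_Ln_term by (simp add: exp_of_real)

text \<open>On the lower line the argument 1 - exp x / a changes sign at \<open>ln a\<close>, and
  the logarithm has imaginary part 0 or pi according to that sign, constant on each side. Inside the
  strip the conjugation puts the argument into the upper half-plane, where \<open>Ln\<close> is
  continuous up to the cut.\<close>

lemma bottom_ok_refl_Ln_term:
  assumes a: "a > 0" shows "bottom_ok True (refl_strip (Ln_term a)) {ln a}"
proof (rule bottom_okI)
  show "continuous_on {z. 0 \<le> Im z \<and> Im z < pi \<and> (Im z = 0 \<longrightarrow> Re z \<notin> {ln a})} (refl_strip (Ln_term a))"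
  proof -
    let ?D = "{z. 0 \<le> Im z \<and> Im z < pi \<and> (Im z = 0 \<longrightarrow> Re z \<notin> {ln a})}"
    have "1 - cnj (exp z) / of_real a \<in> {w. 0 \<le> Im w \<and> w \<noteq> 0}" if "z \<in> ?D" for z
    proof (cases "Im z = 0")
      case True
      then have "z = of_real (Re z)" by (simp add: complex_eq_iff)
      then have e: "exp z = of_real (exp (Re z))" by (metis exp_of_real)
      have "exp (Re z) \<noteq> a" using that True by auto
      then have "1 - exp (Re z) / a \<noteq> 0" using a by (simp add: divide_simps)
      then have "of_real (1 - exp (Re z) / a) \<noteq> (0 :: complex)" by (metis of_real_eq_0_iff)
      then show ?thesis by (simp add: e)
    next
      case False
      then have "0 < Im (exp z)" using that by (intro Im_exp_pos) (auto simp: open_strip_def)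
      then have "0 < Im (1 - cnj (exp z) / of_real a)" using a by simp
      then show ?thesis by (metis (mono_tags, lifting) less_imp_le less_irrefl mem_Collect_eq zero_complex.sel(2))
    qed
    then have "continuous_on ?D (\<lambda>z. Ln (1 - cnj (exp z) / of_real a))"
      using a by (intro continuous_on_compose2[OF continuous_on_Ln_upper] continuous_intros) auto
    then show ?thesis unfolding refl_Ln_term[abs_def] by (intro continuous_on_minus continuous_on_cnj)
  qed
  have sgn: "(x < ln a \<and> y < ln a) \<or> (ln a < x \<and> ln a < y)" if "x \<le> y" "{x..y} \<inter> {ln a} = {}" for x y
    using that by auto
  have lt: "exp x < a" if "x < ln a" for x using that a by (metis exp_less_mono exp_ln)
  have gt: "a < exp x" if "ln a < x" for x using that a by (metis exp_less_mono exp_ln)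
  show "Im (refl_strip (Ln_term a) (of_real x)) = Im (refl_strip (Ln_term a) (of_real y))"
    if xy: "x \<le> y" "{x..y} \<inter> {ln a} = {}" for x y
    using sgn[OF xy]
  proof (elim disjE conjE)
    assume "x < ln a" "y < ln a"
    then have "0 < 1 - exp x / a" "0 < 1 - exp y / a" using lt a by simp_all
    then show ?thesis unfolding refl_Ln_term_of_real by (simp add: Ln_of_real del: of_real_diff of_real_divide)
  next
    assume "ln a < x" "ln a < y"
    then have "1 - exp x / a < 0" "1 - exp y / a < 0" using gt a by simp_all
    moreover have "Im (Ln (of_real r)) = pi" if "r < 0" for r
      using that by (simp add: Im_Ln_eq_pi complex_eq_iff)
    ultimately show ?thesis unfolding refl_Ln_term_of_real
      by (simp del: of_real_diff of_real_divide)
  qed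
  \<comment> \<open>This is - ln |1 - exp x / a|; the square gives one differentiable formula for
    both sides of \<open>ln a\<close>.\<close>
  define u where "u x = - ln ((1 - exp x / a)\<^sup>2) / 2" for x
  have r: "Re (refl_strip (Ln_term a) (of_real x)) = u x" if "x \<noteq> ln a" for x
  proof -
    have "1 - exp x / a \<noteq> 0" using that a by (auto simp: divide_simps)
    then show ?thesis unfolding refl_Ln_term_of_real u_def
      by (simp del: of_real_diff of_real_divide add: ln_realpow[of "\<bar>1 - exp x / a\<bar>" 2, simplified])
  qed
  show "0 \<le> Re (refl_strip (Ln_term a) (of_real y) - refl_strip (Ln_term a) (of_real m)) / (y - m)
      - Re (refl_strip (Ln_term a) (of_real m) - refl_strip (Ln_term a) (of_real x)) / (m - x) \<and>
      (True \<longrightarrow> 0 < Re (refl_strip (Ln_term a) (of_real y) - refl_strip (Ln_term a) (of_real m)) / (y - m)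
      - Re (refl_strip (Ln_term a) (of_real m) - refl_strip (Ln_term a) (of_real x)) / (m - x))"
    if xy: "x < m" "m < y" "{x..y} \<inter> {ln a} = {}" for x m y
  proof -
    have side: "(y < ln a) \<or> (ln a < x)" using sgn[of x y] xy by auto
    have "0 < (u y - u m) / (y - m) - (u m - u x) / (m - x)"
    proof (rule strict_slopes[OF xy(1,2), where u' = "\<lambda>t. exp t / (a - exp t)"])
      fix t :: real assume "x \<le> t" "t \<le> y"
      then have "exp t < a \<or> a < exp t" using side lt[of t] gt[of t] by linarith
      then have ne: "a - exp t \<noteq> 0" "0 < (1 - exp t / a)\<^sup>2" using a by (auto simp: divide_simps)
      then have "(u has_real_derivative exp t * (1 - exp t / a) / (a * (1 - exp t / a)\<^sup>2)) (at t)"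
        unfolding u_def using a by (auto intro!: derivative_eq_intros)
      moreover have "exp t * (1 - exp t / a) / (a * (1 - exp t / a)\<^sup>2) = exp t / (a - exp t)"
      proof -
        have e: "1 - exp t / a = (a - exp t) / a" using a by (simp add: diff_divide_distrib)
        show ?thesis unfolding e using a ne(1) by (simp add: power2_eq_square)
      qed
      ultimately show "(u has_real_derivative exp t / (a - exp t)) (at t)" by simp
    next
      fix s t :: real assume st: "x \<le> s" "s < t" "t \<le> y"
      then have "(exp s < a \<and> exp t < a) \<or> (a < exp s \<and> a < exp t)"
        using side lt[of s] lt[of t] gt[of s] gt[of t] by linarith
      then have p: "0 < (a - exp s) * (a - exp t)" by (auto intro: mult_neg_neg)
      then have ne: "a - exp s \<noteq> 0" "a - exp t \<noteq> 0" by auto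
      have "exp t / (a - exp t) - exp s / (a - exp s) = a * (exp t - exp s) / ((a - exp s) * (a - exp t))"
        using ne by (simp add: divide_simps) (simp add: algebra_simps)
      also have "\<dots> > 0" using p a st by simp
      finally show "exp s / (a - exp s) < exp t / (a - exp t)" by simp
    qed
    moreover have "x \<noteq> ln a" "m \<noteq> ln a" "y \<noteq> ln a" using xy side by auto
    ultimately show ?thesis by (simp add: r)
  qed
  fix p assume "p \<in> {ln a}"
  then have p: "p = ln a" by simp
  have "(\<lambda>h. norm (1 - cnj (exp (Complex p h)) / of_real a)) \<midarrow>0\<rightarrow> norm (1 - cnj (exp (Complex p 0)) / of_real a)"
    unfolding Complex_eq using a by (intro tendsto_intros) auto
  moreover have "exp (Complex p 0) = of_real a"
    using a by (simp add: p Complex_eq exp_of_real)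
  ultimately have lim: "((\<lambda>h. norm (1 - cnj (exp (Complex p h)) / of_real a)) \<longlongrightarrow> 0) (at_right 0)"
    using a by (simp add: filterlim_at_split)
  have ne: "1 - cnj (exp (Complex p h)) / of_real a \<noteq> 0" if "0 < h" "h < pi" for h
  proof -
    have "0 < Im (exp (Complex p h))" using that by (intro Im_exp_pos) simp
    then have "0 < Im (1 - cnj (exp (Complex p h)) / of_real a)" using a by simp
    then show ?thesis by force
  qed
  have evne: "eventually (\<lambda>h. 1 - cnj (exp (Complex p h)) / of_real a \<noteq> 0) (at_right 0)"
    unfolding eventually_at_right[OF zero_less_one] using ne by (intro exI[of _ pi]) auto
  then have "filterlim (\<lambda>h. norm (1 - cnj (exp (Complex p h)) / of_real a)) (at_right 0) (at_right 0)"
    by (intro tendsto_imp_filterlim_at_right[OF lim]) (auto elim: eventually_mono)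
  then have "filterlim (\<lambda>h. - ln (norm (1 - cnj (exp (Complex p h)) / of_real a))) at_top (at_right 0)"
    by (intro filterlim_compose[OF filterlim_uminus_at_top_at_bot] filterlim_compose[OF ln_at_0])
  moreover have "eventually (\<lambda>h. - ln (norm (1 - cnj (exp (Complex p h)) / of_real a))
      = Re (refl_strip (Ln_term a) (Complex p h))) (at_right 0)"
    using evne by eventually_elim (simp add: refl_Ln_term)
  ultimately show "filterlim (\<lambda>h. Re (refl_strip (Ln_term a) (Complex p h))) at_top (at_right 0)"
    by (rule filterlim_mono_eventually[OF _ order_refl order_refl])
qed auto

lemma strip_map_Ln_term:
  assumes a: "a > 0" shows "strip_map True (Ln_term a) {} {ln a}"
  unfolding strip_map_def
  using bottom_ok_Ln_term[OF a] bottom_ok_refl_Ln_term[OF a]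
    Im_quotient_pos_of_deriv[OF convex_open_strip _ _ _ Ln_term_deriv[OF a]] less_imp_le by metis

section \<open>Logarithms of the infinite products\<close>

definition Ln_sum :: "nat set \<Rightarrow> (nat \<Rightarrow> real) \<Rightarrow> (nat \<Rightarrow> real) \<Rightarrow> complex \<Rightarrow> complex" where
  "Ln_sum I a \<kappa> z = (\<Sum>\<nu>. if \<nu> \<in> I then of_real (\<kappa> \<nu>) * Ln_term (a \<nu>) z else 0)"

lemma admissible_eventually_large:
  assumes "admissible I a \<kappa>"
  shows "eventually (\<lambda>\<nu>. \<nu> \<in> I \<longrightarrow> K < a \<nu>) sequentially"
proof (cases "finite I")
  case True
  then obtain N where "I \<subseteq> {..<N}" using finite_nat_bounded by auto
  then show ?thesis unfolding eventually_sequentially by (intro exI[of _ N]) auto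
next
  case False
  then have "filterlim a at_top (inf sequentially (principal I))"
    using assms by (auto simp: admissible_def)
  then have "eventually (\<lambda>\<nu>. K < a \<nu>) (inf sequentially (principal I))"
    by (simp add: filterlim_at_top_dense)
  then show ?thesis by (simp add: eventually_inf_principal)
qed

text \<open>From |Ln (1 + u)| \<le> 2 |u| for |u| < 1/2, with u = exp z / a and |exp z| \<le> exp R.
  The threshold 2 exp R for a gives |u| < 1/2, and the majorant becomes 2 exp R \<kappa> /
  a.\<close>

lemma Ln_sum_locally_summable:
  assumes adm: "admissible I a \<kappa>"
  shows "locally_summable (\<lambda>\<nu> z. if \<nu> \<in> I then of_real (\<kappa> \<nu>) * Ln_term (a \<nu>) z else 0)"
  unfolding locally_summable_def
proof
  fix R
  define r where "r \<nu> = (if \<nu> \<in> I then \<kappa> \<nu> / a \<nu> else 0)" for \<nu>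
  have pos: "\<And>\<nu>. \<nu> \<in> I \<Longrightarrow> 0 < a \<nu> \<and> 0 < \<kappa> \<nu>" using adm by (auto simp: admissible_def)
  have "(\<lambda>\<nu>. \<kappa> \<nu> / a \<nu>) summable_on I" using adm by (simp add: admissible_def)
  moreover have "r summable_on UNIV \<longleftrightarrow> (\<lambda>\<nu>. \<kappa> \<nu> / a \<nu>) summable_on I"
    by (rule summable_on_cong_neutral) (auto simp: r_def)
  ultimately have "r summable_on UNIV" by simp
  then have "summable r"
    using pos by (subst (asm) summable_on_UNIV_nonneg_real_iff) (auto simp: r_def less_imp_le)
  then have "summable (\<lambda>\<nu>. 2 * exp R * r \<nu>)" by (rule summable_mult)
  moreover have "eventually (\<lambda>\<nu>. \<forall>z. \<bar>Re z\<bar> \<le> R \<longrightarrow>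
      norm (if \<nu> \<in> I then of_real (\<kappa> \<nu>) * Ln_term (a \<nu>) z else 0) \<le> 2 * exp R * r \<nu>) sequentially"
    using admissible_eventually_large[OF adm, of "2 * exp R"]
  proof eventually_elim
    case (elim \<nu>)
    show ?case
    proof (intro allI impI)
      fix z :: complex assume z: "\<bar>Re z\<bar> \<le> R"
      show "norm (if \<nu> \<in> I then of_real (\<kappa> \<nu>) * Ln_term (a \<nu>) z else 0) \<le> 2 * exp R * r \<nu>"
      proof (cases "\<nu> \<in> I")
        case True
        then have p: "0 < a \<nu>" "0 < \<kappa> \<nu>" and large: "2 * exp R < a \<nu>" using pos elim by auto
        have n: "norm (exp z / of_real (a \<nu>)) \<le> exp R / a \<nu>"
          using z p by (simp add: norm_divide divide_right_mono)
        also have "\<dots> < 1 / 2" using large p by (simp add: field_simps)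
        finally have "norm (Ln_term (a \<nu>) z) \<le> 2 * norm (exp z / of_real (a \<nu>))"
          unfolding Ln_term_def by (rule norm_Ln_le)
        also have "\<dots> \<le> 2 * (exp R / a \<nu>)" using n by simp
        finally have "\<kappa> \<nu> * norm (Ln_term (a \<nu>) z) \<le> \<kappa> \<nu> * (2 * (exp R / a \<nu>))"
          using p by (intro mult_left_mono) auto
        then show ?thesis using True p by (simp add: r_def norm_mult mult.commute mult.left_commute)
      qed (simp add: r_def)
    qed
  qed
  ultimately show "\<exists>M. summable M \<and> eventually (\<lambda>\<nu>. \<forall>z. \<bar>Re z\<bar> \<le> R \<longrightarrow>
      norm (if \<nu> \<in> I then of_real (\<kappa> \<nu>) * Ln_term (a \<nu>) z else 0) \<le> M \<nu>) sequentially" by blast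
qed

lemma strip_map_Ln_sum:
  assumes adm: "admissible I a \<kappa>"
  shows "\<exists>Q. strip_map (I \<noteq> {}) (Ln_sum I a \<kappa>) {} Q"
proof -
  have pos: "\<And>\<nu>. \<nu> \<in> I \<Longrightarrow> 0 < a \<nu> \<and> 0 < \<kappa> \<nu>" using adm by (auto simp: admissible_def)
  define F where "F = (\<lambda>\<nu> z. if \<nu> \<in> I then of_real (\<kappa> \<nu>) * Ln_term (a \<nu>) z else 0)"
  define Q where "Q \<nu> = (if \<nu> \<in> I then {ln (a \<nu>)} else {})" for \<nu>
  have F: "strip_map (\<nu> \<in> I) (F \<nu>) {} (Q \<nu>)" for \<nu>
    using strip_map_scale[OF strip_map_Ln_term, of "a \<nu>" "\<kappa> \<nu>"] strip_map_affine[of 0 0] pos[of \<nu>]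
    by (cases "\<nu> \<in> I") (simp_all add: F_def Q_def)
  have ls: "locally_summable F" using Ln_sum_locally_summable[OF adm] by (simp add: F_def)
  \<comment> \<open>\<open>exp R < a \<nu>\<close> puts \<open>ln (a \<nu>)\<close> beyond the
    window [-R, R].\<close>
  have ev: "eventually (\<lambda>\<nu>. ({} \<union> Q \<nu>) \<inter> {- R..R} = {}) sequentially" for R
    using admissible_eventually_large[OF adm, of "exp R"]
  proof eventually_elim
    case (elim \<nu>)
    have "R < ln (a \<nu>)" if "\<nu> \<in> I" using elim pos[OF that] that ln_less_cancel_iff[of "exp R" "a \<nu>"] by simp
    then show ?case by (auto simp: Q_def)
  qed
  have "strip_map (\<exists>\<nu>. \<nu> \<in> I) (\<lambda>z. \<Sum>\<nu>. F \<nu> z) (\<Union>\<nu>::nat. {}) (\<Union>\<nu>. Q \<nu>)"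
    by (rule strip_map_suminf[OF F ls ev])
  then show ?thesis by (auto simp: F_def Ln_sum_def[abs_def] ex_in_conv)
qed

lemma power_prod_eq:
  assumes adm: "admissible I a \<kappa>" and w: "\<And>\<nu>. \<nu> \<in> I \<Longrightarrow> w \<nu> = 1 + exp z / of_real (a \<nu>)" "\<And>\<nu>. \<nu> \<in> I \<Longrightarrow> w \<nu> \<noteq> 0"
  shows "power_prod I \<kappa> w = exp (Ln_sum I a \<kappa> z)"
proof -
  let ?f = "\<lambda>\<nu>. if \<nu> \<in> I then of_real (\<kappa> \<nu>) * Ln_term (a \<nu>) z else 0"
  have "power_prod I \<kappa> w = (\<Prod>\<nu>. exp (?f \<nu>))"
    unfolding power_prod_def
  proof (intro arg_cong[where f=prodinf] ext)
    fix \<nu>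
    show "(if \<nu> \<in> I then w \<nu> powr of_real (\<kappa> \<nu>) else 1) = exp (?f \<nu>)"
      using w(2)[of \<nu>] unfolding Ln_term_def by (auto simp: powr_def simp flip: w(1))
  qed
  also have "\<dots> = exp (Ln_sum I a \<kappa> z)"
    unfolding Ln_sum_def by (rule prodinf_exp[OF locally_summableD[OF Ln_sum_locally_summable[OF adm]]])
  finally show ?thesis .
qed

text \<open>For one reflection or one inversion: each brings a single conjugation, which is moved
  through the series. Where both occur the conjugations cancel and the plain version
  applies.\<close>

lemma power_prod_eq_cnj:
  assumes adm: "admissible I a \<kappa>"
    and w: "\<And>\<nu>. \<nu> \<in> I \<Longrightarrow> w \<nu> \<noteq> 0" "\<And>\<nu>. \<nu> \<in> I \<Longrightarrow> Ln (w \<nu>) = cnj (Ln_term (a \<nu>) z)"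
  shows "power_prod I \<kappa> w = exp (cnj (Ln_sum I a \<kappa> z))"
proof -
  let ?f = "\<lambda>\<nu>. if \<nu> \<in> I then of_real (\<kappa> \<nu>) * Ln_term (a \<nu>) z else 0"
  have s: "?f sums Ln_sum I a \<kappa> z"
    unfolding Ln_sum_def by (rule summable_sums[OF locally_summableD[OF Ln_sum_locally_summable[OF adm]]])
  then have c: "(\<lambda>\<nu>. cnj (?f \<nu>)) sums cnj (Ln_sum I a \<kappa> z)" by (rule iffD2[OF sums_cnj])
  have "power_prod I \<kappa> w = (\<Prod>\<nu>. exp (cnj (?f \<nu>)))"
    unfolding power_prod_def
  proof (intro arg_cong[where f=prodinf] ext)
    fix \<nu>
    show "(if \<nu> \<in> I then w \<nu> powr of_real (\<kappa> \<nu>) else 1) = exp (cnj (?f \<nu>))"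
      using w[of \<nu>] by (simp add: powr_def)
  qed
  also have "\<dots> = exp (cnj (Ln_sum I a \<kappa> z))"
    using prodinf_exp[OF sums_summable[OF c]] sums_unique[OF c] by simp
  finally show ?thesis .
qed

lemma strip_map_scale_nonneg:
  assumes "strip_map True F {} {}" and "0 \<le> k"
  shows "strip_map (0 < k) (\<lambda>z. of_real k * F z) {} {}"
  using strip_map_scale[OF assms(1)] strip_map_affine[of 0 0] assms(2) by (cases "k = 0") auto

lemma exp_add_pi_ii: "exp (z + \<i> * of_real pi) = - exp z"
  by (simp add: exp_add)

text \<open>The sum is strict as soon as one part is. If no part were, A and A0 would vanish and all
  products would be empty, leaving exp C z^B, which is excluded.\<close>

lemma W_strip_map:
  fixes W :: "complex \<Rightarrow> complex"
    and A A0 B :: real and C :: complex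
    and Ia Ib Ic Id :: "nat set"
    and a b c d \<kappa> \<Lambda> \<kappa>' \<Lambda>' :: "nat \<Rightarrow> real"
  assumes "A \<ge> 0" "A0 \<ge> 0"
    and a: "admissible Ia a \<kappa>" and b: "admissible Ib b \<Lambda>"
    and c: "admissible Ic c \<kappa>'" and d: "admissible Id d \<Lambda>'"
    and W_form: "\<And>z. z \<in> uhp \<Longrightarrow>
      W z = exp (of_real A * z + C + of_real A0 / z) * z powr of_real B
        * (power_prod Ia \<kappa> (\<lambda>\<nu>. 1 + z / of_real (a \<nu>))
             / power_prod Ib \<Lambda> (\<lambda>\<mu>. 1 - z / of_real (b \<mu>)))
        * (power_prod Ic \<kappa>' (\<lambda>\<nu>. 1 + 1 / (z * of_real (c \<nu>)))
             / power_prod Id \<Lambda>' (\<lambda>\<mu>. 1 - 1 / (z * of_real (d \<mu>))))"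
    and W_nontrivial: "\<not> (\<forall>z\<in>uhp. W z = exp C * z powr of_real B)"
  obtains F P Q where "strip_map True F P Q" "\<And>z. z \<in> open_strip \<Longrightarrow> W (exp z) = exp (F z)"
proof -
  define G where "G z = of_real B * z + C + of_real A * exp z + of_real A0 * inv_strip exp z
     + Ln_sum Ia a \<kappa> z + refl_strip (Ln_sum Ib b \<Lambda>) z
     + inv_strip (Ln_sum Ic c \<kappa>') z + inv_strip (refl_strip (Ln_sum Id d \<Lambda>')) z" for z
  obtain Qa Qb Qc Qd where
    Q: "strip_map (Ia \<noteq> {}) (Ln_sum Ia a \<kappa>) {} Qa" "strip_map (Ib \<noteq> {}) (Ln_sum Ib b \<Lambda>) {} Qb"
      "strip_map (Ic \<noteq> {}) (Ln_sum Ic c \<kappa>') {} Qc" "strip_map (Id \<noteq> {}) (Ln_sum Id d \<Lambda>') {} Qd"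
    using strip_map_Ln_sum a b c d by meson
  have "strip_map True (inv_strip exp) {} {}" using strip_map_inv[OF strip_map_exp] by simp
  note sum1 = strip_map_add[OF strip_map_add[OF strip_map_affine[of B C]
      strip_map_scale_nonneg[OF strip_map_exp \<open>A \<ge> 0\<close>]] strip_map_scale_nonneg[OF this \<open>A0 \<ge> 0\<close>]]
  note sum2 = strip_map_add[OF strip_map_add[OF sum1 Q(1)] strip_map_refl[OF Q(2)]]
  note sum3 = strip_map_add[OF strip_map_add[OF sum2 strip_map_inv[OF Q(3)]]
      strip_map_inv[OF strip_map_refl[OF Q(4)]]]
  have "\<exists>P Q. strip_map (((((((False \<or> 0 < A) \<or> 0 < A0) \<or> Ia \<noteq> {}) \<or> Ib \<noteq> {}) \<or> Ic \<noteq> {}) \<or> Id \<noteq> {})) G P Q"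
    unfolding G_def[abs_def] by (intro exI) (rule sum3)
  moreover have "((((((False \<or> 0 < A) \<or> 0 < A0) \<or> Ia \<noteq> {}) \<or> Ib \<noteq> {}) \<or> Ic \<noteq> {}) \<or> Id \<noteq> {}) = True"
  proof (rule ccontr)
    assume "\<not> ?thesis"
    then have e: "A = 0" "A0 = 0" "Ia = {}" "Ib = {}" "Ic = {}" "Id = {}"
      using assms(1,2) by auto
    have "power_prod {} k w = 1" for k w by (simp add: power_prod_def)
    then show False using W_nontrivial W_form e by simp
  qed
  ultimately obtain P Q where sm: "strip_map True G P Q" by auto
  have "W (exp z) = exp (G z)" if z: "z \<in> open_strip" for z
  proof -
    let ?Z = "exp z"
    have im: "0 < Im ?Z" by (rule Im_exp_pos[OF z])
    \<comment> \<open>The inverse lies in the lower half-plane, so the inverted factors are not real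
      either: they do not vanish, and \<open>Ln\<close> commutes with conjugation at them.\<close>
    have im': "Im (1 / ?Z) < 0" using im by (auto simp: Im_divide intro!: divide_pos_pos add_nonneg_pos)
    have nz: "w \<noteq> 0 \<and> w \<notin> \<real>\<^sub>\<le>\<^sub>0" if "Im w \<noteq> 0" for w
      using that by (auto simp: complex_nonpos_Reals_iff)
    have ka: "0 < a \<nu>" if "\<nu> \<in> Ia" for \<nu> using that a by (auto simp: admissible_def)
    have kb: "0 < b \<nu>" if "\<nu> \<in> Ib" for \<nu> using that b by (auto simp: admissible_def)
    have kc: "0 < c \<nu>" if "\<nu> \<in> Ic" for \<nu> using that c by (auto simp: admissible_def)
    have kd: "0 < d \<nu>" if "\<nu> \<in> Id" for \<nu> using that d by (auto simp: admissible_def)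
    have pa: "power_prod Ia \<kappa> (\<lambda>\<nu>. 1 + ?Z / of_real (a \<nu>)) = exp (Ln_sum Ia a \<kappa> z)"
    proof (rule power_prod_eq[OF a refl])
      fix \<nu> assume "\<nu> \<in> Ia"
      then have "Im (1 + ?Z / of_real (a \<nu>)) \<noteq> 0" using im ka[of \<nu>] by simp
      then show "1 + ?Z / of_real (a \<nu>) \<noteq> 0" using nz by blast
    qed
    have pb: "power_prod Ib \<Lambda> (\<lambda>\<nu>. 1 - ?Z / of_real (b \<nu>)) = exp (- refl_strip (Ln_sum Ib b \<Lambda>) z)"
      unfolding refl_strip_def minus_minus
    proof (rule power_prod_eq_cnj[OF b])
      fix \<nu> assume "\<nu> \<in> Ib"
      then have i: "Im (1 - ?Z / of_real (b \<nu>)) \<noteq> 0" using im kb[of \<nu>] by simp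
      then show "1 - ?Z / of_real (b \<nu>) \<noteq> 0" using nz by blast
      have "Ln_term (b \<nu>) (cnj z + \<i> * of_real pi) = Ln (cnj (1 - ?Z / of_real (b \<nu>)))"
        unfolding Ln_term_def exp_add_pi_ii by (simp add: exp_cnj)
      also have "\<dots> = cnj (Ln (1 - ?Z / of_real (b \<nu>)))" using nz[OF i] by (intro cnj_Ln[symmetric]) simp
      finally show "Ln (1 - ?Z / of_real (b \<nu>)) = cnj (Ln_term (b \<nu>) (cnj z + \<i> * of_real pi))" by simp
    qed
    have pc: "power_prod Ic \<kappa>' (\<lambda>\<nu>. 1 + 1 / (?Z * of_real (c \<nu>))) = exp (inv_strip (Ln_sum Ic c \<kappa>') z)"
      unfolding inv_strip_def
    proof (rule power_prod_eq_cnj[OF c])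
      fix \<nu> assume "\<nu> \<in> Ic"
      have e: "1 + 1 / (?Z * of_real (c \<nu>)) = 1 + (1 / ?Z) / of_real (c \<nu>)" by simp
      have "Im (1 + (1 / ?Z) / of_real (c \<nu>)) = Im (1 / ?Z) / c \<nu>"
        by (simp only: plus_complex.sel one_complex.sel Im_divide_of_real add_0)
      then have i: "Im (1 + 1 / (?Z * of_real (c \<nu>))) \<noteq> 0"
        unfolding e using im' kc[OF \<open>\<nu> \<in> Ic\<close>] by simp
      then show "1 + 1 / (?Z * of_real (c \<nu>)) \<noteq> 0" using nz by blast
      have "Ln_term (c \<nu>) (- cnj z) = Ln (cnj (1 + 1 / (?Z * of_real (c \<nu>))))"
        unfolding Ln_term_def by (simp add: exp_cnj exp_minus divide_inverse)
      also have "\<dots> = cnj (Ln (1 + 1 / (?Z * of_real (c \<nu>))))" using nz[OF i] by (intro cnj_Ln[symmetric]) simp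
      finally show "Ln (1 + 1 / (?Z * of_real (c \<nu>))) = cnj (Ln_term (c \<nu>) (- cnj z))" by simp
    qed
    have pd: "power_prod Id \<Lambda>' (\<lambda>\<nu>. 1 - 1 / (?Z * of_real (d \<nu>)))
        = exp (- inv_strip (refl_strip (Ln_sum Id d \<Lambda>')) z)"
    proof -
      have "power_prod Id \<Lambda>' (\<lambda>\<nu>. 1 - 1 / (?Z * of_real (d \<nu>))) = exp (Ln_sum Id d \<Lambda>' (- z + \<i> * of_real pi))"
      proof (rule power_prod_eq[OF d])
        fix \<nu> assume "\<nu> \<in> Id"
        show "1 - 1 / (?Z * of_real (d \<nu>)) = 1 + exp (- z + \<i> * of_real pi) / of_real (d \<nu>)"
          unfolding exp_add_pi_ii by (simp add: exp_minus divide_inverse)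
        have e: "1 - 1 / (?Z * of_real (d \<nu>)) = 1 - (1 / ?Z) / of_real (d \<nu>)" by simp
        have "Im (1 - (1 / ?Z) / of_real (d \<nu>)) = - (Im (1 / ?Z) / d \<nu>)"
          by (simp only: minus_complex.sel one_complex.sel Im_divide_of_real diff_0)
        then have i: "Im (1 - 1 / (?Z * of_real (d \<nu>))) \<noteq> 0"
          unfolding e using im' kd[OF \<open>\<nu> \<in> Id\<close>] by simp
        then show "1 - 1 / (?Z * of_real (d \<nu>)) \<noteq> 0" using nz by blast
      qed
      then show ?thesis by (simp add: inv_strip_def refl_strip_def)
    qed
    have "Ln ?Z = z" using z by (intro Ln_exp) (auto simp: open_strip_def)
    then have pw: "?Z powr of_real B = exp (of_real B * z)" by (simp add: powr_def)
    have iz: "of_real A0 / ?Z = of_real A0 * inv_strip exp z"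
      by (simp add: inv_strip_def exp_cnj exp_minus divide_inverse)
    have "?Z \<in> uhp" using im by (simp add: uhp_def)
    from W_form[OF this] show ?thesis
      unfolding pa pb pc pd pw iz G_def by (simp add: exp_add exp_minus divide_inverse)
  qed
  with sm that show ?thesis by blast
qed

section \<open>From the strip to the half-plane\<close>

lemma Ln_in_open_strip: "w \<in> uhp \<Longrightarrow> Ln w \<in> open_strip"
  using Im_Ln_pos_lt_imp[of w] by (auto simp: open_strip_def uhp_def)

lemma at_within_uhp_nontrivial:
  assumes "0 \<le> Im x" shows "at x within uhp \<noteq> bot"
proof -
  have "\<exists>y\<in>uhp. y \<noteq> x \<and> dist y x < e" if "e > 0" for e
  proof (intro bexI conjI)
    show "x + \<i> * of_real (e / 2) \<in> uhp" using assms that by (simp add: uhp_def)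
    show "x + \<i> * of_real (e / 2) \<noteq> x" using that by simp
    show "dist (x + \<i> * of_real (e / 2)) x < e" using that by (simp add: dist_norm norm_mult)
  qed
  then have "x islimpt uhp" by (simp add: islimpt_approachable)
  then show ?thesis by (simp add: trivial_limit_within)
qed

text \<open>Two values of g differ by a multiple of 2 pi i, so distinct ones are at least 2 pi
  apart, and a continuous function with such a range is constant on a connected set.\<close>

lemma exp_const_imp_const:
  fixes g :: "complex \<Rightarrow> complex"
  assumes "connected S" "continuous_on S g" "\<And>z. z \<in> S \<Longrightarrow> exp (g z) = a"
  shows "g constant_on S"
proof (rule continuous_discrete_range_constant[OF assms(1,2)])
  fix x assume x: "x \<in> S"
  have "2 * pi \<le> norm (g y - g x)" if y: "y \<in> S" "g y \<noteq> g x" for y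
  proof -
    have "exp (g y) = exp (g x)" using assms(3) x y by simp
    then obtain n :: int where n: "g y = g x + (of_int (2 * n) * pi) * \<i>" unfolding exp_eq by blast
    then have "n \<noteq> 0" using y by auto
    then have "1 \<le> \<bar>of_int n :: real\<bar>" by linarith
    then have "pi * 2 * 1 \<le> pi * 2 * \<bar>of_int n :: real\<bar>" by (intro mult_left_mono) auto
    then show ?thesis unfolding n by (simp add: norm_mult)
  qed
  then show "\<exists>e>0. \<forall>y. y \<in> S \<and> g y \<noteq> g x \<longrightarrow> e \<le> norm (g y - g x)"
    by (intro exI[of _ "2 * pi"]) auto
qed


lemma tendsto_Ln_uhp:
  assumes "0 \<le> Im x" "x \<noteq> 0"
  shows "(Ln \<longlongrightarrow> Ln x) (at x within uhp)"
proof -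
  have "(Ln \<longlongrightarrow> Ln x) (at x within {w. 0 \<le> Im w \<and> w \<noteq> 0})"
    using continuous_on_Ln_upper assms by (auto simp: continuous_on_def)
  then show ?thesis by (rule tendsto_within_subset) (auto simp: uhp_def)
qed

section \<open>Boundary values of \<open>W\<close> and of its logarithm\<close>

context
  fixes F :: "complex \<Rightarrow> complex" and P Q :: "real set" and W :: "complex \<Rightarrow> complex"
  assumes sm: "strip_map True F P Q"
    and link: "\<And>z. z \<in> open_strip \<Longrightarrow> W (exp z) = exp (F z)"
begin

lemma W_uhp: "w \<in> uhp \<Longrightarrow> W w = exp (F (Ln w))"
  using link[OF Ln_in_open_strip[of w]] by (cases "w = 0") (auto simp: uhp_def)

lemma eventually_uhp: "eventually (\<lambda>w. w \<in> uhp) (at x within uhp)"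
  by (simp add: eventually_at_filter)

lemma branch_tendsto:
  assumes x: "0 \<le> Im x" "x \<noteq> 0" and reg: "Ln x \<in> strip_reg P Q"
  shows "((\<lambda>w. F (Ln w)) \<longlongrightarrow> F (Ln x)) (at x within uhp)"
proof (rule continuous_on_tendsto_compose[OF strip_map_continuous[OF sm] tendsto_Ln_uhp[OF x] reg])
  show "eventually (\<lambda>w. Ln w \<in> strip_reg P Q) (at x within uhp)"
    using eventually_uhp by eventually_elim (use Ln_in_open_strip open_strip_subset_reg in blast)
qed

lemma W_tendsto:
  assumes x: "0 \<le> Im x" "x \<noteq> 0" and reg: "Ln x \<in> strip_reg P Q"
  shows "(W \<longlongrightarrow> exp (F (Ln x))) (at x within uhp)"
proof (rule Lim_transform_eventually)
  show "((\<lambda>w. exp (F (Ln w))) \<longlongrightarrow> exp (F (Ln x))) (at x within uhp)"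
    by (intro tendsto_exp branch_tendsto assms)
  show "eventually (\<lambda>w. exp (F (Ln w)) = W w) (at x within uhp)"
    using eventually_uhp by eventually_elim (simp add: W_uhp)
qed

text \<open>Approach to a real point along a vertical segment of the strip. Since
  \<open>Im (Ln x)\<close> is 0 or pi, the absolute value is h in one case and, for small h, pi - h
  in the other.\<close>

lemma vertical_path:
  assumes x: "Im x = 0" "x \<noteq> 0"
  shows "filterlim (\<lambda>h. exp (Complex (Re (Ln x)) \<bar>Im (Ln x) - h\<bar>)) (at x within uhp) (at_right 0)"
proof -
  have "Im (Ln x) = 0 \<or> Im (Ln x) = pi"
    using x Im_Ln_eq_0[of x] Im_Ln_eq_pi[of x] by (cases "Re x > 0") (auto simp: complex_eq_iff not_less_iff_gr_or_eq)
  then have strip: "Complex (Re (Ln x)) \<bar>Im (Ln x) - h\<bar> \<in> open_strip" if "0 < h" "h < pi" for h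
    using that by auto
  have uhp: "exp (Complex (Re (Ln x)) \<bar>Im (Ln x) - h\<bar>) \<in> uhp" if "0 < h" "h < pi" for h
    using Im_exp_pos[OF strip[OF that]] by (simp add: uhp_def)
  have "(\<lambda>h. exp (Complex (Re (Ln x)) \<bar>Im (Ln x) - h\<bar>)) \<midarrow>0\<rightarrow> exp (Complex (Re (Ln x)) \<bar>Im (Ln x) - 0\<bar>)"
    unfolding Complex_eq by (intro tendsto_intros)
  moreover have "Complex (Re (Ln x)) \<bar>Im (Ln x) - 0\<bar> = Ln x"
    using \<open>Im (Ln x) = 0 \<or> Im (Ln x) = pi\<close> by (auto simp: complex_eq_iff)
  ultimately have lim: "((\<lambda>h. exp (Complex (Re (Ln x)) \<bar>Im (Ln x) - h\<bar>)) \<longlongrightarrow> x) (at_right 0)"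
    using x by (simp add: filterlim_at_split)
  have "eventually (\<lambda>h. exp (Complex (Re (Ln x)) \<bar>Im (Ln x) - h\<bar>) \<in> uhp \<and>
      exp (Complex (Re (Ln x)) \<bar>Im (Ln x) - h\<bar>) \<noteq> x) (at_right 0)"
    unfolding eventually_at_right[OF zero_less_one]
  proof (intro exI[of _ pi] conjI pi_gt_zero allI impI)
    fix h assume h: "0 < h" "h < pi"
    from uhp[OF h] show "exp (Complex (Re (Ln x)) \<bar>Im (Ln x) - h\<bar>) \<in> uhp" .
    then show "exp (Complex (Re (Ln x)) \<bar>Im (Ln x) - h\<bar>) \<noteq> x" using x(1) by (auto simp: uhp_def)
  qed
  then show ?thesis unfolding filterlim_at using lim by simp
qed

text \<open>Along the vertical at a singularity |W| tends to infinity on the lower line and to 0 on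
  the upper one; a finite nonzero limit excludes both.\<close>

lemma reg_of_tendsto:
  assumes x: "x \<noteq> 0" "Im x = 0" and w: "(W \<longlongrightarrow> w) (at x within uhp)" "w \<noteq> 0"
  shows "Ln x \<in> strip_reg P Q"
proof (rule ccontr)
  assume no: "Ln x \<notin> strip_reg P Q"
  let ?p = "Re (Ln x)"
  have lim: "((\<lambda>h. norm (W (exp (Complex ?p \<bar>Im (Ln x) - h\<bar>)))) \<longlongrightarrow> norm w) (at_right 0)"
    by (intro tendsto_norm filterlim_compose[OF w(1) vertical_path] x)
  have "Im (Ln x) = 0 \<or> Im (Ln x) = pi"
    using x Im_Ln_eq_0[of x] Im_Ln_eq_pi[of x] by (cases "Re x > 0") (auto simp: complex_eq_iff not_less_iff_gr_or_eq)
  then consider "Im (Ln x) = 0" "?p \<in> P" | "Im (Ln x) = pi" "?p \<in> Q"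
    using no by (auto simp: strip_reg_def)
  then show False
  proof cases
    case 1
    have "filterlim (\<lambda>h. exp (Re (F (Complex ?p h)))) at_top (at_right 0)"
      by (intro filterlim_compose[OF exp_at_top] bottom_blowup[OF sm] 1)
    moreover have "eventually (\<lambda>h. exp (Re (F (Complex ?p h))) = norm (W (exp (Complex ?p \<bar>Im (Ln x) - h\<bar>)))) (at_right 0)"
      unfolding eventually_at_right[OF zero_less_one]
      by (intro exI[of _ pi]) (auto simp: 1 link)
    ultimately have "filterlim (\<lambda>h. norm (W (exp (Complex ?p \<bar>Im (Ln x) - h\<bar>)))) at_top (at_right 0)"
      by (rule filterlim_mono_eventually[OF _ order_refl order_refl])
    then show False
      using not_tendsto_and_filterlim_at_infinity[OF trivial_limit_at_right_real lim]
        filterlim_at_top_imp_at_infinity by blast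
  next
    case 2
    have "filterlim (\<lambda>h. exp (- Re (refl_strip F (Complex ?p h)))) (nhds 0) (at_right 0)"
      by (intro filterlim_compose[OF exp_at_bot] filterlim_compose[OF filterlim_uminus_at_bot_at_top]
          bottom_blowup[OF strip_map_refl[OF sm]] 2)
    moreover have "eventually (\<lambda>h. exp (- Re (refl_strip F (Complex ?p h))) = norm (W (exp (Complex ?p \<bar>Im (Ln x) - h\<bar>)))) (at_right 0)"
      unfolding eventually_at_right[OF zero_less_one]
      by (intro exI[of _ pi]) (auto simp: 2 link refl_strip_Complex)
    ultimately have "((\<lambda>h. norm (W (exp (Complex ?p \<bar>Im (Ln x) - h\<bar>)))) \<longlongrightarrow> 0) (at_right 0)"
      by (rule Lim_transform_eventually)
    from tendsto_unique[OF trivial_limit_at_right_real lim this] show False using w(2) by simp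
  qed
qed

text \<open>A nonzero limit of W determines F only up to multiples of 2 pi i. Near the origin W / w
  avoids the cut, so F - Ln (W / w) is a continuous logarithm of the constant w and therefore a
  constant c.\<close>

lemma left_limit_of_tendsto:
  assumes w: "(W \<longlongrightarrow> w) (at 0 within uhp)" "w \<noteq> 0"
  obtains c where "left_limit F c" "exp c = w" "((\<lambda>v. F (Ln v)) \<longlongrightarrow> c) (at 0 within uhp)"
proof -
  have R: "\<exists>R. \<forall>z\<in>open_strip. Re z < R \<longrightarrow> dist (W (exp z)) w < e" if "e > 0" for e
  proof -
    from tendstoD[OF w(1) that] obtain d where d: "d > 0" "\<And>v. v \<in> uhp \<Longrightarrow> v \<noteq> 0 \<Longrightarrow> dist v 0 < d \<Longrightarrow> dist (W v) w < e"
      unfolding eventually_at by blast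
    have "dist (W (exp z)) w < e" if "z \<in> open_strip" "Re z < ln d" for z
    proof (rule d(2))
      show "exp z \<in> uhp" using Im_exp_pos that(1) by (simp add: uhp_def)
      have "exp (Re z) < exp (ln d)" using that(2) by simp
      then show "dist (exp z) 0 < d" using d(1) by simp
    qed simp
    then show ?thesis by blast
  qed
  \<comment> \<open>The radius |w| confines W / w to the open unit disc about 1, which misses the
    nonpositive reals.\<close>
  from R[of "norm w"] w(2) obtain R1 where R1: "\<And>z. z \<in> open_strip \<Longrightarrow> Re z < R1 \<Longrightarrow> dist (W (exp z)) w < norm w"
    by auto
  define S where "S = open_strip \<inter> {z. Re z < R1}"
  have near1: "W (exp z) / w \<notin> \<real>\<^sub>\<le>\<^sub>0" if "z \<in> S" for z
  proof
    assume "W (exp z) / w \<in> \<real>\<^sub>\<le>\<^sub>0"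
    then have "Re (W (exp z) / w) \<le> 0" by (simp add: complex_nonpos_Reals_iff)
    then have "1 \<le> Re (1 - W (exp z) / w)" by simp
    also have "\<dots> \<le> norm (1 - W (exp z) / w)" by (rule complex_Re_le_cmod)
    also have "1 - W (exp z) / w = (w - W (exp z)) / w" using w(2) by (simp add: diff_divide_distrib)
    also have "norm \<dots> < 1"
      using R1[of z] that w(2) by (simp add: S_def norm_divide dist_norm norm_minus_commute)
    finally show False by simp
  qed
  define g where "g z = F z - Ln (exp (F z) / w)" for z
  have "convex S" unfolding S_def by (intro convex_Int convex_open_strip convex_halfspace_Re_lt)
  moreover have "continuous_on S g"
  proof -
    have cF: "continuous_on S F"
      using strip_map_continuous[OF sm] open_strip_subset_reg by (auto simp: S_def intro: continuous_on_subset)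
    have "exp (F z) / w \<notin> \<real>\<^sub>\<le>\<^sub>0" if "z \<in> S" for z using near1[OF that] link[of z] that by (simp add: S_def)
    then show ?thesis unfolding g_def using w(2) cF by (intro continuous_intros) auto
  qed
  moreover have "exp (g z) = w" for z
    using w(2) by (simp add: g_def exp_diff)
  ultimately have "g constant_on S"
    using exp_const_imp_const[of S g w] convex_connected by blast
  then obtain c where c: "\<And>z. z \<in> S \<Longrightarrow> g z = c" by (auto simp: constant_on_def)
  have ne: "\<exists>z. z \<in> open_strip \<and> Re z < r" for r
    by (intro exI[of _ "Complex (r - 1) 1"]) (use pi_gt3 in auto)
  then obtain z0 where "z0 \<in> S" by (auto simp: S_def)
  then have ec: "exp c = w" using c \<open>\<And>z. exp (g z) = w\<close> by metis
  have ll: "left_limit F c"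
    unfolding left_limit_def
  proof (intro allI impI)
    fix e :: real assume "e > 0"
    have "isCont Ln 1" by (intro continuous_at_Ln) auto
    then obtain d where d: "d > 0" "\<And>v. dist v 1 < d \<Longrightarrow> dist (Ln v) (Ln 1) < e"
      using \<open>e > 0\<close> unfolding continuous_at_eps_delta by blast
    from R[of "d * norm w"] d w(2) obtain R2 where
      R2: "\<And>z. z \<in> open_strip \<Longrightarrow> Re z < R2 \<Longrightarrow> dist (W (exp z)) w < d * norm w" by auto
    have "dist (F z) c < e" if z: "z \<in> open_strip" "Re z < min R1 R2" for z
    proof -
      have "W (exp z) / w - 1 = (W (exp z) - w) / w" using w(2) by (simp add: diff_divide_distrib)
      then have "dist (W (exp z) / w) 1 < d"
        using R2[of z] z w(2) by (simp add: dist_norm norm_divide divide_less_eq)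
      from d(2)[OF this] have "norm (Ln (exp (F z) / w)) < e" using link z by (simp add: dist_norm)
      moreover have "F z - c = Ln (exp (F z) / w)" using c[of z] z by (simp add: S_def g_def algebra_simps)
      ultimately show ?thesis by (simp add: dist_norm)
    qed
    then show "\<exists>R. \<forall>w\<in>open_strip. Re w < R \<longrightarrow> dist (F w) c < e" by blast
  qed
  have "((\<lambda>v. F (Ln v)) \<longlongrightarrow> c) (at 0 within uhp)"
  proof (rule tendstoI)
    fix e :: real assume "e > 0"
    then obtain R3 where R3: "\<And>z. z \<in> open_strip \<Longrightarrow> Re z < R3 \<Longrightarrow> dist (F z) c < e"
      using ll unfolding left_limit_def by blast
    show "eventually (\<lambda>v. dist (F (Ln v)) c < e) (at 0 within uhp)"
      unfolding eventually_at
    proof (intro exI[of _ "exp R3"] conjI ballI impI)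
      fix v assume v: "v \<in> uhp" "v \<noteq> 0 \<and> dist v 0 < exp R3"
      then have "ln (norm v) < R3" by (metis dist_0_norm dist_commute exp_less_cancel_iff exp_ln zero_less_norm_iff)
      then show "dist (F (Ln v)) c < e" using v Ln_in_open_strip by (intro R3) auto
    qed simp
  qed
  with ll ec that show ?thesis by blast
qed

text \<open>\<open>arg_gain\<close> admits any continuous logarithm of W, and v ->
  \<open>F (Ln v)\<close> is one. Two of them differ by a constant on the connected half-plane,
  which cancels in the increment.\<close>

lemma arg_gain_eq:
  assumes g: "arg_gain W z1 z2 \<delta>" and z: "0 \<le> Im z1" "0 \<le> Im z2"
    and c1: "((\<lambda>v. F (Ln v)) \<longlongrightarrow> c1) (at z1 within uhp)"
    and c2: "((\<lambda>v. F (Ln v)) \<longlongrightarrow> c2) (at z2 within uhp)"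
  shows "\<delta> = Im c2 - Im c1"
proof -
  obtain L l1 l2 where L: "continuous_on uhp L" "\<And>z. z \<in> uhp \<Longrightarrow> exp (L z) = W z"
    "(L \<longlongrightarrow> l1) (at z1 within uhp)" "(L \<longlongrightarrow> l2) (at z2 within uhp)" "\<delta> = Im l2 - Im l1"
    using g unfolding arg_gain_def by blast
  have "convex uhp" unfolding uhp_def by (rule convex_halfspace_Im_gt)
  moreover have "continuous_on uhp (\<lambda>v. L v - F (Ln v))"
  proof -
    have "continuous_on uhp Ln"
      by (rule continuous_on_subset[OF continuous_on_Ln_upper]) (auto simp: uhp_def)
    then have "continuous_on uhp (\<lambda>v. F (Ln v))"
      using Ln_in_open_strip open_strip_subset_reg
      by (intro continuous_on_compose2[OF strip_map_continuous[OF sm]]) blast+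
    then show ?thesis by (intro continuous_intros L(1))
  qed
  moreover have "exp (L v - F (Ln v)) = 1" if "v \<in> uhp" for v
    using L(2)[OF that] W_uhp[OF that] by (simp add: exp_diff)
  ultimately have "(\<lambda>v. L v - F (Ln v)) constant_on uhp"
    using exp_const_imp_const convex_connected by blast
  then obtain k where k: "\<And>v. v \<in> uhp \<Longrightarrow> L v - F (Ln v) = k" by (auto simp: constant_on_def)
  have lim: "l = c + k" if "(L \<longlongrightarrow> l) (at x within uhp)" "((\<lambda>v. F (Ln v)) \<longlongrightarrow> c) (at x within uhp)" "0 \<le> Im x" for x l c
  proof (rule tendsto_unique[OF at_within_uhp_nontrivial[OF that(3)] that(1)])
    show "(L \<longlongrightarrow> c + k) (at x within uhp)"
    proof (rule Lim_transform_eventually)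
      show "((\<lambda>v. F (Ln v) + k) \<longlongrightarrow> c + k) (at x within uhp)" by (intro tendsto_intros that)
      show "eventually (\<lambda>v. F (Ln v) + k = L v) (at x within uhp)"
        using eventually_uhp by eventually_elim (metis k add.commute diff_add_cancel)
    qed
  qed
  show ?thesis using lim[OF L(3) c1 z(1)] lim[OF L(4) c2 z(2)] L(5) by simp
qed

end

section \<open>The increment of the argument against the prescribed angle\<close>

theorem theorem13:
  fixes W :: "complex \<Rightarrow> complex"
    and A A0 B :: real and C :: complex
    and Ia Ib Ic Id :: "nat set"
    and a b c d \<kappa> \<Lambda> \<kappa>' \<Lambda>' :: "nat \<Rightarrow> real"
    and \<alpha> z1 z2 :: complex and \<theta> :: real
  assumes "A \<ge> 0" and "A0 \<ge> 0"
    and "admissible Ia a \<kappa>" and "admissible Ib b \<Lambda>"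
    and "admissible Ic c \<kappa>'" and "admissible Id d \<Lambda>'"
    and W_form: "\<And>z. z \<in> uhp \<Longrightarrow>
      W z = exp (of_real A * z + C + of_real A0 / z) * z powr of_real B
        * (power_prod Ia \<kappa> (\<lambda>\<nu>. 1 + z / of_real (a \<nu>))
             / power_prod Ib \<Lambda> (\<lambda>\<mu>. 1 - z / of_real (b \<mu>)))
        * (power_prod Ic \<kappa>' (\<lambda>\<nu>. 1 + 1 / (z * of_real (c \<nu>)))
             / power_prod Id \<Lambda>' (\<lambda>\<mu>. 1 - 1 / (z * of_real (d \<mu>))))"
    and W_real: "\<And>x. x \<in> finite_points W \<Longrightarrow> Im x = 0 \<Longrightarrow> (W \<longlongrightarrow> W x) (at x within uhp)"
    and W_nontrivial: "\<not> (\<forall>z\<in>uhp. W z = exp C * z powr of_real B)"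
    and "\<alpha> \<noteq> 0"
    and "z1 \<in> finite_points W" and "z2 \<in> finite_points W"
    and "norm z1 < norm z2"
    and "W z1 = \<alpha>"
    and "W z2 = \<alpha> * exp (\<i> * of_real \<theta>)" and "admissible_angle W z1 z2 \<theta>"
    and not_exceptional: "\<not> ([\<theta> = 0] (rmod (2 * pi)) \<and>
        z1 \<in> \<real> \<and> z2 \<in> \<real> \<and> sgn (Re z1) = sgn (Re z2) \<and>
        (\<forall>z \<in> semi_annulus z1 z2 \<inter> finite_points W. norm (W z) \<noteq> norm \<alpha>))"
  shows "\<forall>\<rho>\<in>{0<..<\<theta>}. \<exists>z \<in> semi_annulus z1 z2 \<inter> finite_points W.
           W z = \<alpha> * exp (\<i> * of_real \<rho>)"
proof
  fix \<rho> assume \<rho>: "\<rho> \<in> {0<..<\<theta>}"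
  obtain F P Q where sm: "strip_map True F P Q" and link: "\<And>z. z \<in> open_strip \<Longrightarrow> W (exp z) = exp (F z)"
    using W_strip_map[OF assms(1-6) W_form W_nontrivial] by blast
  have closed_uhp: "0 \<le> Im z" if "z \<in> finite_points W" for z
    using that by (auto simp: finite_points_def uhp_def)
  \<comment> \<open>At real points W is tied to the branch only through limits within
    \<open>uhp\<close>, so the values are identified by uniqueness of limits.\<close>
  have value_eq: "W x = w" if x: "x \<in> finite_points W" "x \<noteq> 0" and "Ln x \<in> strip_reg P Q" "w = exp (F (Ln x))" for x w
  proof (cases "x \<in> uhp")
    case True
    then show ?thesis using W_uhp[OF sm link] that by simp
  next
    case False
    then have "Im x = 0" using x by (auto simp: finite_points_def)
    then show ?thesis
      using tendsto_unique[OF at_within_uhp_nontrivial W_real[OF x(1)] W_tendsto[OF sm link]] that by simp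
  qed
  have reg: "Ln x \<in> strip_reg P Q" if x: "x \<in> finite_points W" "x \<noteq> 0" "W x \<noteq> 0" for x
  proof (cases "x \<in> uhp")
    case True
    then show ?thesis using Ln_in_open_strip open_strip_subset_reg by blast
  next
    case False
    then have "Im x = 0" using x by (auto simp: finite_points_def)
    then show ?thesis using reg_of_tendsto[OF sm link x(2)] W_real[OF x(1)] x(3) by blast
  qed
  have finite_exp: "exp z \<in> finite_points W" "W (exp z) = exp (F z)" if z: "z \<in> strip_reg P Q" for z
  proof -
    have Im: "0 \<le> Im z" "Im z \<le> pi" using z by (auto simp: strip_reg_def)
    have Lz: "Ln (exp z) = z" using Im pi_gt_zero by (intro Ln_exp) linarith+
    have im: "0 \<le> Im (exp z)" using Im by (simp add: Im_exp sin_ge_zero)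
    show fin: "exp z \<in> finite_points W"
    proof (cases "exp z \<in> uhp")
      case False
      then have "Im (exp z) = 0" using im by (simp add: uhp_def)
      moreover have "(W \<longlongrightarrow> exp (F z)) (at (exp z) within uhp)"
        using W_tendsto[OF sm link im] z Lz by simp
      ultimately show ?thesis by (auto simp: finite_points_def)
    qed (simp add: finite_points_def)
    show "W (exp z) = exp (F z)" using value_eq[OF fin] z Lz by simp
  qed
  have z2: "z2 \<noteq> 0" using \<open>norm z1 < norm z2\<close> by auto
  have W2: "W z2 \<noteq> 0" using \<open>\<alpha> \<noteq> 0\<close> \<open>W z2 = _\<close> by simp
  define \<zeta> where "\<zeta> = Ln z2"
  have \<zeta>: "\<zeta> \<in> strip_reg P Q" "exp (F \<zeta>) = \<alpha> * exp (\<i> * of_real \<theta>)" "exp \<zeta> = z2"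
    "((\<lambda>v. F (Ln v)) \<longlongrightarrow> F \<zeta>) (at z2 within uhp)"
    unfolding \<zeta>_def
    using reg[OF \<open>z2 \<in> _\<close> z2 W2] value_eq[OF \<open>z2 \<in> _\<close> z2 _ refl] \<open>W z2 = _\<close> z2
      branch_tendsto[OF sm link closed_uhp[OF \<open>z2 \<in> _\<close>] z2] by auto
  have lev: "Re (F \<zeta>) = Re c" if "exp c = \<alpha>" for c
  proof -
    have "norm (exp (F \<zeta>)) = norm (exp c)" unfolding \<zeta>(2) that by (simp add: norm_mult)
    then show ?thesis by simp
  qed
  have rotated: "\<exists>k::int. Im (F \<zeta>) - Im c = \<theta> + of_int k * (2 * pi)" if "exp c = \<alpha>" for c
  proof -
    have "exp (F \<zeta>) = exp (c + \<i> * of_real \<theta>)" unfolding \<zeta>(2) by (simp add: exp_add that)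
    then obtain n :: int where "F \<zeta> = c + \<i> * of_real \<theta> + (of_int (2 * n) * pi) * \<i>" unfolding exp_eq by blast
    then show ?thesis by (intro exI[of _ n]) simp
  qed
  \<comment> \<open>The logarithm of \<alpha> that the branch takes at z1, as a limit at the left
    end when z1 = 0. Both cases deliver the same data, and \<open>not_exceptional\<close> is used
    only for z1 \<noteq> 0.\<close>
  obtain c where c: "exp c = \<alpha>" "((\<lambda>v. F (Ln v)) \<longlongrightarrow> c) (at z1 within uhp)"
    and gain: "Im c < Im (F \<zeta>)"
    and attained: "\<And>y. Im c < y \<Longrightarrow> y < Im (F \<zeta>) \<Longrightarrow>
      \<exists>w\<in>strip_reg P Q. norm z1 < exp (Re w) \<and> Re w < Re \<zeta> \<and> F w = Complex (Re c) y"
  proof (cases "z1 = 0")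
    case True
    have "(W \<longlongrightarrow> \<alpha>) (at 0 within uhp)" using W_real[OF \<open>z1 \<in> _\<close>] True \<open>W z1 = \<alpha>\<close> by simp
    then obtain c where c: "left_limit F c" "exp c = \<alpha>" "((\<lambda>v. F (Ln v)) \<longlongrightarrow> c) (at 0 within uhp)"
      using left_limit_of_tendsto[OF sm link] \<open>\<alpha> \<noteq> 0\<close> by blast
    show ?thesis
      using that[OF c(2)] left_limit_level[OF sm c(1) \<zeta>(1) lev[OF c(2)]] c(3) True by auto
  next
    case False
    define \<xi> where "\<xi> = Ln z1"
    have \<xi>: "\<xi> \<in> strip_reg P Q" "exp (F \<xi>) = \<alpha>" "exp \<xi> = z1"
      "((\<lambda>v. F (Ln v)) \<longlongrightarrow> F \<xi>) (at z1 within uhp)"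
      unfolding \<xi>_def
      using reg[OF \<open>z1 \<in> _\<close> False] value_eq[OF \<open>z1 \<in> _\<close> False _ refl] \<open>W z1 = _\<close> False
        \<open>\<alpha> \<noteq> 0\<close> branch_tendsto[OF sm link closed_uhp[OF \<open>z1 \<in> _\<close>] False] by auto
    have n1: "norm z1 = exp (Re \<xi>)" and n2: "norm z2 = exp (Re \<zeta>)"
      using \<xi>(3) \<zeta>(3) by (metis norm_exp_eq_Re)+
    have lt: "Re \<xi> < Re \<zeta>" using \<open>norm z1 < norm z2\<close> by (simp add: n1 n2)
    note eq = lev[OF \<xi>(2)]
    have gain: "Im (F \<xi>) < Im (F \<zeta>)"
    proof (rule ccontr)
      assume no: "\<not> ?thesis"
      then have Im_eq: "Im (F \<zeta>) = Im (F \<xi>)" using Im_mono[OF sm \<xi>(1) \<zeta>(1) lt] eq by simp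
      \<comment> \<open>Without a gain every alternative of \<open>gain_pos\<close> fails: both
        points share a boundary line and the level is not met in between. Equality of the imaginary
        parts then makes \<theta> a multiple of 2 pi, which completes the exceptional case.\<close>
      have "\<not> (Im \<xi> \<noteq> Im \<zeta> \<or> (0 < Im \<xi> \<and> Im \<xi> < pi) \<or>
          (\<exists>w\<in>strip_reg P Q. Re \<xi> < Re w \<and> Re w < Re \<zeta> \<and> Re (F w) = Re (F \<xi>)))"
        using gain_pos[OF sm \<xi>(1) \<zeta>(1) lt refl eq] no by blast
      then have line: "Im \<xi> = Im \<zeta>" "Im \<xi> = 0 \<or> Im \<xi> = pi"
        and empty: "\<And>w. w \<in> strip_reg P Q \<Longrightarrow> Re \<xi> < Re w \<Longrightarrow> Re w < Re \<zeta> \<Longrightarrow> Re (F w) \<noteq> Re (F \<xi>)"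
        using \<xi>(1) by (auto simp: strip_reg_def)
      from rotated[OF \<xi>(2)] obtain k :: int where k: "\<theta> + of_int k * (2 * pi) = 0" using Im_eq by auto
      then have "[\<theta> = 0] (rmod (2 * pi))" unfolding rcong_altdef by (intro exI[of _ k]) simp
      moreover have "z1 \<in> \<real>" "z2 \<in> \<real>" "sgn (Re z1) = sgn (Re z2)"
        using line \<xi>(3) \<zeta>(3) by (auto simp: complex_is_Real_iff Im_exp Re_exp sgn_mult)
      moreover have "norm (W z) \<noteq> norm \<alpha>" if z: "z \<in> semi_annulus z1 z2 \<inter> finite_points W" for z
      proof
        assume e: "norm (W z) = norm \<alpha>"
        have z0: "z \<noteq> 0" "W z \<noteq> 0" using z e \<open>\<alpha> \<noteq> 0\<close> by (auto simp: semi_annulus_def)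
        have r: "Ln z \<in> strip_reg P Q" using reg z z0 by blast
        then have "W z = exp (F (Ln z))" using value_eq z z0 by blast
        then have "norm (exp (F (Ln z))) = norm (exp (F \<xi>))" using e \<xi>(2) by simp
        then have "Re (F (Ln z)) = Re (F \<xi>)" by simp
        moreover have "exp (Re \<xi>) < exp (Re (Ln z))" "exp (Re (Ln z)) < exp (Re \<zeta>)"
          using z z0 by (auto simp: semi_annulus_def n1 n2)
        ultimately show False using empty[OF r] by simp
      qed
      ultimately show False using not_exceptional by blast
    qed
    have "\<exists>w\<in>strip_reg P Q. norm z1 < exp (Re w) \<and> Re w < Re \<zeta> \<and> F w = Complex (Re (F \<xi>)) y"
      if "Im (F \<xi>) < y" "y < Im (F \<zeta>)" for y
      using level_value_attained[OF sm \<xi>(1) \<zeta>(1) lt refl eq that] by (metis exp_less_mono n1)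
    with that[OF \<xi>(2,4) gain] show ?thesis by blast
  qed
  have turn: "\<exists>z \<in> semi_annulus z1 z2 \<inter> finite_points W. W z = \<alpha> * exp (\<i> * of_real \<tau>)"
    if \<tau>: "0 < \<tau>" "\<tau> < Im (F \<zeta>) - Im c" for \<tau>
  proof -
    obtain w where w: "w \<in> strip_reg P Q" "norm z1 < exp (Re w)" "Re w < Re \<zeta>" "F w = Complex (Re c) (Im c + \<tau>)"
      using attained[of "Im c + \<tau>"] \<tau> by auto
    have "norm z2 = exp (Re \<zeta>)" using \<zeta>(3) by (metis norm_exp_eq_Re)
    moreover have "exp w \<in> closure uhp"
    proof -
      have "0 \<le> Im (exp w)" using w(1) by (simp add: strip_reg_def Im_exp sin_ge_zero)
      then have "exp w \<in> uhp \<or> exp w islimpt uhp"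
        using at_within_uhp_nontrivial[of "exp w"] by (simp add: trivial_limit_within)
      then show ?thesis by (auto simp: closure_def)
    qed
    ultimately have "exp w \<in> semi_annulus z1 z2" using w by (simp add: semi_annulus_def)
    moreover have "F w = c + \<i> * of_real \<tau>" using w(4) by (simp add: complex_eq_iff)
    then have "W (exp w) = \<alpha> * exp (\<i> * of_real \<tau>)" using finite_exp(2)[OF w(1)] c(1) by (simp add: exp_add)
    ultimately show ?thesis using finite_exp(1)[OF w(1)] by blast
  qed
  show "\<exists>z \<in> semi_annulus z1 z2 \<inter> finite_points W. W z = \<alpha> * exp (\<i> * of_real \<rho>)"
  proof (cases "\<theta> \<le> 2 * pi")
    case True
    obtain k :: int where k: "Im (F \<zeta>) - Im c = \<theta> + of_int k * (2 * pi)" using rotated[OF c(1)] by blast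
    \<comment> \<open>A positive increment \<theta> + 2 pi k with \<theta> \<le> 2 pi forces k > -1,
      so the increment is at least \<theta>.\<close>
    have "- (2 * pi) < of_int k * (2 * pi)" using gain True k by linarith
    then have "- 1 * (2 * pi) < of_int k * (2 * pi)" by simp
    then have "(- 1 :: real) < of_int k" using mult_less_cancel_right_pos[of "2 * pi" "- 1" "of_int k"] by simp
    then have "0 \<le> k" by linarith
    then have "\<theta> \<le> Im (F \<zeta>) - Im c" unfolding k by simp
    then show ?thesis using turn \<rho> by simp
  next
    case False
    then obtain \<delta> where "arg_gain W z1 z2 \<delta>" "2 * pi < \<delta>"
      using \<open>admissible_angle W z1 z2 \<theta>\<close> unfolding admissible_angle_def by blast
    \<comment> \<open>The increment is only known to exceed one full turn and may be smaller than
      \<theta>. This suffices because the values on the circle repeat.\<close>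
    then have big: "2 * pi < Im (F \<zeta>) - Im c"
      using arg_gain_eq[OF sm link _ _ _ c(2) \<zeta>(4)] closed_uhp \<open>z1 \<in> _\<close> \<open>z2 \<in> _\<close> by metis
    \<comment> \<open>The ceiling minus one, not the floor, puts the representative \<tau> of \<rho>
      into (0, 2 pi], so that \<tau> is never 0; the strict inequality \<open>big\<close> admits
      \<tau> = 2 pi.\<close>
    define n where "n = \<lceil>\<rho> / (2 * pi)\<rceil> - 1"
    define \<tau> where "\<tau> = \<rho> - of_int n * (2 * pi)"
    have "of_int n < \<rho> / (2 * pi)" "\<rho> / (2 * pi) \<le> of_int n + 1"
      unfolding n_def by linarith+
    then have "of_int n * (2 * pi) < \<rho>" "\<rho> \<le> (of_int n + 1) * (2 * pi)"
      by (simp_all add: field_simps)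
    then have "0 < \<tau>" "\<tau> \<le> 2 * pi" by (simp_all add: \<tau>_def algebra_simps)
    moreover have "cis \<tau> = cis \<rho>"
      by (rule cis_cong) (auto simp: rcong_altdef \<tau>_def)
    then have "exp (\<i> * of_real \<tau>) = exp (\<i> * of_real \<rho>)" by (simp add: cis_conv_exp)
    ultimately show ?thesis using turn[of \<tau>] big by simp
  qed
qed

end
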